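(* Let $d\ge1$ and let $\mathbf{x}\in\mathbb{R}^d$ be a standard Laplace random vector, and set $S=\sum_{j=1}^d|x_j|$. For every function $f:\partial B_1^d\to\mathbb{R}$ that is $1$-Lipschitz (with respect to the Euclidean norm) and all $r>0$, \[ \mathbb{P}\big(|f(\mathbf{x}/S)-\mathbb{E}f(\mathbf{x}/S)|>r\big)\le 361\exp\{-0.003\,rd\}. \]
   Context: A real random variable is standard Laplace if it has density $e^{-|x|}/2$; a random vector in $\mathbb{R}^d$ is a standard Laplace vector if its coordinates are independent standard Laplace random variables. $\partial B_1^d=\{\mathbf{x}\in\mathbb{R}^d:\sum_{i}|x_i|=1\}$. *)

theory Defs
  imports "HOL-Probability.Probability"
begin

definition laplace_density :: "real \<Rightarrow> ennreal" where
  "laplace_density t = ennreal (exp (- \<bar>t\<bar>) / 2)"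

definition l1_sphere :: "(real ^ 'n) set" where
  "l1_sphere = {x. (\<Sum>i\<in>UNIV. \<bar>x $ i\<bar>) = 1}"

end

theory Submission
  imports Defs
begin

text \<open>
  The proof follows Maurey's approach to concentration. For the Laplace distribution on the line,
  whenever \<open>F x * G y \<le> exp (w (x - y))\<close> for all \<open>x\<close>, \<open>y\<close>, where \<open>w s = (sqrt (4 + s\<^sup>2) - 2) / 10\<close>, one has
  \<open>E F * E G \<le> 1\<close>. This is shown by monotone transport for the exponential distribution, passes to the
  Laplace distribution as a difference of two independent exponentials, and tensorizes.

  Let \<open>h x = f (x / S x)\<close> and \<open>\<theta> = 0.003 d\<close>. If \<open>y\<close> is typical, i.e. \<open>S y\<close> is of order \<open>d\<close> and \<open>norm y\<close> of
  order \<open>sqrt d\<close>, then \<open>\<theta> * \<bar>h x - h y\<bar>\<close> is at most a constant plus \<open>\<Sum>i. w (x i - y i)\<close>, for every \<open>x \<noteq> 0\<close>.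
  With a cutoff \<open>\<chi>\<close> to typical points this gives \<open>E (exp (\<theta> h)) * E (\<chi> exp (-\<theta> h)) \<le> C\<close> and the same
  for \<open>-h\<close>. As \<open>E (\<chi> exp (\<theta> h)) * E (\<chi> exp (-\<theta> h)) \<ge> (E \<chi>)\<^sup>2\<close>, the product
  \<open>E (exp (\<theta> h)) * E (exp (-\<theta> h))\<close> is bounded; by Jensen both factors are bounded after centring \<open>h\<close> at
  its mean, and Markov's inequality concludes.
\<close>

subsection \<open>Transport for the exponential distribution\<close>

text \<open>Serves to differentiate the transport map. As \<open>f\<close> may miss values,
  \<open>inv f\<close> is differentiated only at points \<open>f x\<close>, near which the
  intermediate value theorem supplies preimages.\<close>

lemma DERIV_inv_increasing:
  fixes f f' :: "real \<Rightarrow> real"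
  assumes D: "\<And>x. DERIV f x :> f' x" and pos: "\<And>x. 0 < f' x"
  shows "inj f" "DERIV (inv f) (f x) :> inverse (f' x)"
proof -
  have less: "f a < f b" if "a < b" for a b
    using DERIV_pos_imp_increasing[OF that, of f] D pos by blast
  show inj: "inj f"
    by (rule injI) (metis less linorder_neqE_linordered_idom order_less_irrefl)
  have cont: "isCont f z" for z
    using D DERIV_isCont by blast
  show "DERIV (inv f) (f x) :> inverse (f' x)"
  proof (rule DERIV_inverse_function[where f = f and a = "f (x - 1)" and b = "f (x + 1)"])
    show "DERIV f (inv f (f x)) :> f' x" using D inj by simp
    show "f' x \<noteq> 0" using pos[of x] by simp
    show "f (x - 1) < f x" "f x < f (x + 1)" by (auto intro: less)
    show "isCont (inv f) (f x)"
      by (rule isCont_inverse_function2[of "x - 1" x "x + 1"]) (use inj cont in auto)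
  next
    fix y assume "f (x - 1) < y" "y < f (x + 1)"
    then obtain z where "f z = y"
      using IVT[of f "x - 1" y "x + 1"] cont by auto
    then show "f (inv f y) = y" by (metis f_inv_into_f rangeI)
  qed
qed

text \<open>With \<open>g = sqrt (1 + s\<^sup>2) - 1\<close>, the two exponents differ by
  \<open>3/20 * g\<close>, while the fraction lost in the last factor is at most
  \<open>g / (8 * (1 + g))\<close>. Since 1/8 is less than 3/20, the gain wins.\<close>

lemma exp_cost_le:
  fixes s :: real
  shows "exp ((sqrt (1 + s\<^sup>2) - 1) / 10)
    \<le> exp ((sqrt (1 + s\<^sup>2) - 1) / 4) * (1 - (s / sqrt (1 + s\<^sup>2))\<^sup>2 / 16)"
proof -
  define g where "g = sqrt (1 + s\<^sup>2) - 1"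
  have g0: "g \<ge> 0" by (simp add: g_def)
  have sq: "(1 + g)\<^sup>2 = 1 + s\<^sup>2" by (simp add: g_def)
  then have s2: "s\<^sup>2 = g\<^sup>2 + 2 * g" by (simp add: power2_eq_square algebra_simps)
  define q where "q = (s / sqrt (1 + s\<^sup>2))\<^sup>2"
  have q: "q = (g\<^sup>2 + 2 * g) / (1 + g)\<^sup>2"
    unfolding q_def sq power_divide s2 by (simp flip: s2)
  have "g\<^sup>2 + 2 * g \<le> 2 * g * (1 + g)"
    using g0 by (simp add: power2_eq_square algebra_simps)
  then have "q \<le> 2 * g * (1 + g) / (1 + g)\<^sup>2"
    unfolding q using g0 by (intro divide_right_mono) auto
  also have "\<dots> = 2 * g / (1 + g)" using g0 by (simp add: power2_eq_square)
  finally have q2: "q \<le> 2 * g / (1 + g)" .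
  have "(1 + 3/20 * g) * (q / 16) \<le> (1 + g) * ((2 * g / (1 + g)) / 16)"
    using q2 g0 by (intro mult_mono divide_right_mono) (auto simp: q)
  also have "\<dots> = g / 8" using g0 by (simp add: field_simps)
  finally have "1 \<le> (1 + 3/20 * g) * (1 - q / 16)"
    using g0 by (simp add: algebra_simps)
  also have "\<dots> \<le> exp (3/20 * g) * (1 - q / 16)"
  proof (rule mult_right_mono[OF exp_ge_add_one_self])
    have "2 * g / (1 + g) \<le> 2" using g0 by (simp add: field_simps)
    then show "0 \<le> 1 - q / 16" using q2 by linarith
  qed
  finally have "exp (g / 10) * 1 \<le> exp (g / 10) * (exp (3/20 * g) * (1 - q / 16))"
    by (intro mult_left_mono) auto
  also have "\<dots> = exp (g / 4) * (1 - q / 16)"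
  proof -
    have "g / 10 + 3/20 * g = g / 4" by simp
    then show ?thesis by (metis exp_add mult.assoc)
  qed
  finally show ?thesis by (simp add: g_def q_def)
qed

text \<open>
  A Prekopa--Leindler argument: with \<open>T\<close> transporting \<open>\<phi>\<close> to \<open>\<gamma>\<close>, the point
  \<open>z x = (x + T x) / 2 - (sqrt (1 + (x - T x)\<^sup>2) - 1) / 8\<close> lies so far below the midpoint that the gain in
  \<open>exp (- z x)\<close> pays for the cost, while \<open>z'\<close> still dominates \<open>sqrt (T')\<close> up to the factor in
  \<open>exp_cost_le\<close>.
\<close>

lemma transport_core:
  fixes \<phi> \<gamma> \<Phi> \<Gamma> :: "real \<Rightarrow> real"
  assumes D\<Phi>: "\<And>x. DERIV \<Phi> x :> \<phi> x" and D\<Gamma>: "\<And>x. DERIV \<Gamma> x :> \<gamma> x"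
    and \<phi>: "\<And>x. 0 < \<phi> x" and \<gamma>: "\<And>x. 0 < \<gamma> x"
    and \<Phi>0: "\<Phi> 0 = 0" and \<Gamma>0: "\<Gamma> 0 = 0"
    and \<Phi>I: "(\<Phi> \<longlongrightarrow> I) at_top" and \<Gamma>J: "(\<Gamma> \<longlongrightarrow> J) at_top"
    and le: "\<And>x y. \<phi> x * \<gamma> y \<le> exp ((sqrt (1 + (x - y)\<^sup>2) - 1) / 10 - x - y)"
  shows "I * J \<le> 1"
proof -
  have lt\<Phi>: "\<Phi> a < \<Phi> b" if "a < b" for a b
    using DERIV_pos_imp_increasing[OF that, of \<Phi>] D\<Phi> \<phi> by blast
  have lt\<Gamma>: "\<Gamma> a < \<Gamma> b" if "a < b" for a b
    using DERIV_pos_imp_increasing[OF that, of \<Gamma>] D\<Gamma> \<gamma> by blast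
  have le\<Phi>: "\<Phi> a \<le> \<Phi> b" if "a \<le> b" for a b
    using lt\<Phi>[of a b] that by (cases "a = b") auto
  have le\<Gamma>: "\<Gamma> a \<le> \<Gamma> b" if "a \<le> b" for a b
    using lt\<Gamma>[of a b] that by (cases "a = b") auto
  have \<Phi>lt: "\<Phi> a < I" for a
  proof -
    have "\<Phi> (a + 1) \<le> I"
      by (rule tendsto_lowerbound[OF \<Phi>I])
        (auto simp: eventually_at_top_linorder intro!: exI[of _ "a+1"] le\<Phi>)
    then show ?thesis using lt\<Phi>[of a "a + 1"] by simp
  qed
  have I: "I > 0" using \<Phi>lt[of 0] \<Phi>0 by simp
  have J: "J > 0"
  proof -
    have "\<Gamma> 1 \<le> J"
      by (rule tendsto_lowerbound[OF \<Gamma>J])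
        (auto simp: eventually_at_top_linorder intro!: exI[of _ 1] le\<Gamma>)
    then show ?thesis using lt\<Gamma>[of 0 1] \<Gamma>0 by simp
  qed
  \<comment> \<open>The masses \<open>I\<close> and \<open>J\<close> may differ; scaling by their
    ratio lets \<open>\<Phi>\<close> and \<open>\<Gamma>\<close> exhaust their ranges
    together.\<close>
  define \<rho> where "\<rho> = J / I"
  have \<rho>: "\<rho> > 0" using I J by (simp add: \<rho>_def)
  \<comment> \<open>Monotone transport: \<open>\<Gamma> (T x) = \<rho> * \<Phi> x\<close>, solvable
    for \<open>x \<ge> 0\<close> because the right side then stays between 0 and
    \<open>J\<close>.\<close>
  define T where "T x = inv \<Gamma> (\<rho> * \<Phi> x)" for x
  have inj: "inj \<Gamma>" by (rule DERIV_inv_increasing[OF D\<Gamma> \<gamma>])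
  have surj: "\<exists>t. \<Gamma> t = \<rho> * \<Phi> x" if "x \<ge> 0" for x
  proof -
    have "\<rho> * \<Phi> x < \<rho> * I" using \<Phi>lt \<rho> by simp
    also have "\<dots> = J" using I by (simp add: \<rho>_def)
    finally have "\<forall>\<^sub>F y in at_top. \<rho> * \<Phi> x < \<Gamma> y" using order_tendstoD(1)[OF \<Gamma>J] by blast
    then obtain N where N: "\<And>y. y \<ge> N \<Longrightarrow> \<rho> * \<Phi> x < \<Gamma> y"
      by (auto simp: eventually_at_top_linorder)
    have "\<Phi> x \<ge> 0" using lt\<Phi>[of 0 x] \<Phi>0 that by (cases "x = 0") auto
    then have "\<Gamma> 0 \<le> \<rho> * \<Phi> x" using \<rho> \<Gamma>0 by simp
    moreover have "\<rho> * \<Phi> x \<le> \<Gamma> (max N 0)" using N[of "max N 0"] by simp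
    moreover have "\<forall>y. 0 \<le> y \<and> y \<le> max N 0 \<longrightarrow> isCont \<Gamma> y" using D\<Gamma> DERIV_isCont by blast
    ultimately show ?thesis using IVT[of \<Gamma> 0 "\<rho> * \<Phi> x" "max N 0"] by auto
  qed
  have \<Gamma>T: "\<Gamma> (T x) = \<rho> * \<Phi> x" if "x \<ge> 0" for x
    using surj[OF that] unfolding T_def by (metis f_inv_into_f rangeI)
  have DT: "DERIV T x :> \<rho> * \<phi> x / \<gamma> (T x)" if "x \<ge> 0" for x
  proof -
    have "DERIV (inv \<Gamma>) (\<rho> * \<Phi> x) :> inverse (\<gamma> (T x))"
      using DERIV_inv_increasing(2)[OF D\<Gamma> \<gamma>, of "T x"] \<Gamma>T[OF that] by simp
    from DERIV_chain2[OF this DERIV_cmult[OF D\<Phi>[of x]]] show ?thesis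
      unfolding T_def by (simp add: field_simps)
  qed
  have T0: "T 0 = 0"
    unfolding T_def \<Phi>0 using inv_f_f[OF inj, of 0] \<Gamma>0 by simp
  define z where "z x = (x + T x) / 2 - (sqrt (1 + (x - T x)\<^sup>2) - 1) / 8" for x
  \<comment> \<open>A change of variables along \<open>z\<close>, phrased as monotonicity: once
    \<open>D\<close> is nondecreasing on the half line, \<open>D 0 = - 1\<close> gives
    \<open>sqrt \<rho> * \<Phi> R \<le> 1\<close>, and in the limit \<open>sqrt \<rho> * I\<close>
    is \<open>sqrt (I * J)\<close>.\<close>
  define D where "D x = - exp (- z x) - sqrt \<rho> * \<Phi> x" for x
  have mono: "D 0 \<le> D R" if "R \<ge> 0" for R
  proof (rule DERIV_nonneg_imp_nondecreasing[OF that])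
    fix x :: real assume x: "0 \<le> x" "x \<le> R"
    define s where "s = x - T x"
    \<comment> \<open>An eighth of the derivative of \<open>sqrt (1 + s\<^sup>2)\<close> in
      \<open>s\<close>, so that the correction term of \<open>z\<close> contributes
      \<open>- k * (1 - T')\<close> to the derivative.\<close>
    define k where "k = s / sqrt (1 + s\<^sup>2) / 8"
    define T' where "T' = \<rho> * \<phi> x / \<gamma> (T x)"
    define z' where "z' = (1 + T') / 2 - k * (1 - T')"
    have s0: "1 + s\<^sup>2 > 0" by (simp add: add_pos_nonneg)
    have DT': "DERIV T x :> T'" using DT x by (simp add: T'_def)
    have "DERIV (\<lambda>x. 1 + (x - T x)\<^sup>2) x :> 2 * s * (1 - T')"
      unfolding s_def by (rule derivative_eq_intros DT' refl)+ simp
    from DERIV_chain2[OF DERIV_real_sqrt this]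
    have "DERIV (\<lambda>x. sqrt (1 + (x - T x)\<^sup>2)) x
        :> inverse (sqrt (1 + s\<^sup>2)) / 2 * (2 * s * (1 - T'))"
      using s0 unfolding s_def by blast
    also have "inverse (sqrt (1 + s\<^sup>2)) / 2 * (2 * s * (1 - T')) = 8 * k * (1 - T')"
      unfolding k_def divide_inverse by simp
    finally have Ds: "DERIV (\<lambda>x. sqrt (1 + (x - T x)\<^sup>2)) x :> 8 * k * (1 - T')" .
    have Dz: "DERIV z x :> z'"
      unfolding z_def
      by (rule DERIV_cong[OF DERIV_diff[OF DERIV_cdivide[OF DERIV_add[OF DERIV_ident DT']]
            DERIV_cdivide[OF DERIV_diff[OF Ds DERIV_const]]]]) (simp add: z'_def)
    have DD: "DERIV D x :> exp (- z x) * z' - sqrt \<rho> * \<phi> x"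
      unfolding D_def
      by (rule DERIV_cong[OF DERIV_diff[OF DERIV_minus[OF DERIV_chain2[OF DERIV_exp DERIV_minus[OF Dz]]]
            DERIV_cmult[OF D\<Phi>]]]) simp
    have T'0: "T' > 0" unfolding T'_def using \<rho> \<phi> \<gamma> by simp
    have "\<bar>s\<bar> \<le> sqrt (1 + s\<^sup>2)" by (rule real_le_rsqrt) simp
    then have k: "\<bar>k\<bar> \<le> 1/8" using s0 by (simp add: k_def abs_divide) 
    have z'eq: "z' = (1/2 - k) + (1/2 + k) * T'" by (simp add: z'_def field_simps)
    have z'0: "z' \<ge> 0" 
    proof -
      have "0 \<le> 1/2 - k" "0 \<le> 1/2 + k" using k by linarith+
      then show ?thesis unfolding z'eq using T'0 mult_nonneg_nonneg[of "1/2 + k" T'] by linarith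
    qed
    \<comment> \<open>Arithmetic-geometric mean inequality for \<open>1/2 - k\<close> and
      \<open>(1/2 + k) * T'\<close>.\<close>
    have z'sq: "(1 - 4 * k\<^sup>2) * T' \<le> z'\<^sup>2"
    proof -
      have "z'\<^sup>2 - (1 - 4 * k\<^sup>2) * T' = ((1/2 - k) - (1/2 + k) * T')\<^sup>2"
        unfolding z'eq by (simp add: power2_eq_square algebra_simps)
      then show ?thesis using zero_le_power2[of "(1/2 - k) - (1/2 + k) * T'"] by linarith
    qed
    have "sqrt \<rho> * \<phi> x \<le> exp (- z x) * z'"
    proof (rule power2_le_imp_le)
      \<comment> \<open>Trading one factor \<open>\<rho> * \<phi> x\<close> for
        \<open>T' * \<gamma> (T x)\<close> makes the hypothesis \<open>le\<close> applicable at the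
        pair \<open>x\<close>, \<open>T x\<close>.\<close>
      have "(sqrt \<rho> * \<phi> x)\<^sup>2 = T' * (\<phi> x * \<gamma> (T x))"
        unfolding T'_def using \<rho> \<gamma>[of "T x"] by (simp add: power_mult_distrib power2_eq_square)
      also have "\<dots> \<le> T' * exp ((sqrt (1 + s\<^sup>2) - 1) / 10 - x - T x)"
        using le[of x "T x"] T'0 by (intro mult_left_mono) (auto simp: s_def)
      also have "\<dots> = T' * (exp (- x - T x) * exp ((sqrt (1 + s\<^sup>2) - 1) / 10))"
        by (simp add: exp_add[symmetric])
      also have "\<dots> \<le> T' * (exp (- x - T x) * (exp ((sqrt (1 + s\<^sup>2) - 1) / 4) * (1 - 4 * k\<^sup>2)))"
      proof -
        have "4 * k\<^sup>2 = (s / sqrt (1 + s\<^sup>2))\<^sup>2 / 16"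
          unfolding k_def power_divide[of "s / sqrt (1 + s\<^sup>2)" 8] by simp
        then show ?thesis
          using exp_cost_le[of s] T'0 by (intro mult_left_mono) (simp_all only: exp_ge_zero less_imp_le)
      qed
      also have "\<dots> = (exp (- z x))\<^sup>2 * ((1 - 4 * k\<^sup>2) * T')"
      proof -
        have "- x - T x + (sqrt (1 + s\<^sup>2) - 1) / 4 = 2 * (- z x)"
        proof -
          have "- a - b + (g - 1) / 4 = 2 * (- ((a + b) / 2 - (g - 1) / 8))" for a b g :: real
            by (simp add: field_simps)
          then show ?thesis unfolding z_def s_def[symmetric] .
        qed
        then have *: "(exp (- z x))\<^sup>2 = exp (- x - T x) * exp ((sqrt (1 + s\<^sup>2) - 1) / 4)"
          by (simp only: exp_add[symmetric] exp_double)
        show ?thesis unfolding * by (simp only: mult_ac)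
      qed
      also have "\<dots> \<le> (exp (- z x))\<^sup>2 * z'\<^sup>2" using z'sq by (intro mult_left_mono) auto
      finally show "(sqrt \<rho> * \<phi> x)\<^sup>2 \<le> (exp (- z x) * z')\<^sup>2" by (simp add: power_mult_distrib)
    qed (use z'0 in simp)
    then show "\<exists>y. DERIV D x :> y \<and> y \<ge> 0" using DD by auto
  qed
  have "sqrt \<rho> * \<Phi> R \<le> 1" if "R \<ge> 0" for R
  proof -
    have "- 1 \<le> D R" using mono[OF that] by (simp add: D_def z_def T0 \<Phi>0)
    then show ?thesis using exp_gt_zero[of "- z R"] unfolding D_def by linarith
  qed
  then have "sqrt \<rho> * I \<le> 1"
    by (intro tendsto_upperbound[OF tendsto_mult[OF tendsto_const \<Phi>I]])
      (auto simp: eventually_at_top_linorder)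
  then have "(sqrt \<rho> * I)\<^sup>2 \<le> 1" using I \<rho> by (simp add: power_le_one)
  also have "(sqrt \<rho> * I)\<^sup>2 = I * J" using I \<rho> by (simp add: power_mult_distrib) (simp add: \<rho>_def power2_eq_square)
  finally show ?thesis .
qed

text \<open>Dominated convergence along sequences. It keeps partial integrals continuous, so that
  the transport inequality can be applied to them again.\<close>

lemma continuous_on_integral_bounded:
  fixes f :: "real \<Rightarrow> 'a \<Rightarrow> real"
  assumes "finite_measure M" and f[measurable]: "\<And>t. f t \<in> borel_measurable M"
    and cont: "\<And>x. x \<in> space M \<Longrightarrow> continuous_on UNIV (\<lambda>t. f t x)"
    and bound: "\<And>t x. x \<in> space M \<Longrightarrow> \<bar>f t x\<bar> \<le> B"
  shows "continuous_on UNIV (\<lambda>t. \<integral>x. f t x \<partial>M)"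
proof -
  interpret finite_measure M by fact
  show ?thesis
  proof (rule continuous_at_imp_continuous_on, intro ballI continuous_at_sequentiallyI)
    fix t :: real and u :: "nat \<Rightarrow> real" assume u: "u \<longlonglongrightarrow> t"
    show "(\<lambda>n. \<integral>x. f (u n) x \<partial>M) \<longlonglongrightarrow> (\<integral>x. f t x \<partial>M)"
    proof (rule integral_dominated_convergence[where w = "\<lambda>_. B"])
      show "AE x in M. (\<lambda>n. f (u n) x) \<longlonglongrightarrow> f t x"
      proof (rule AE_I2)
        fix x assume "x \<in> space M"
        then have "isCont (\<lambda>t. f t x) t" using cont by (simp add: continuous_on_eq_continuous_at)
        then show "(\<lambda>n. f (u n) x) \<longlonglongrightarrow> f t x" using u by (rule isCont_tendsto_compose)
      qed
    qed (use bound in auto)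
  qed
qed

lemma integrable_bounded:
  fixes f :: "'a \<Rightarrow> real"
  assumes "finite_measure M" "f \<in> borel_measurable M" "\<And>x. x \<in> space M \<Longrightarrow> \<bar>f x\<bar> \<le> B"
  shows "integrable M f"
  using assms by (intro finite_measure.integrable_const_bound[of M f B]) (auto intro: AE_I2)

text \<open>The antiderivative is taken on the whole line, although the exponential law lives on the
  half line, because \<open>transport_core\<close> asks for derivatives everywhere. For
  \<open>y \<ge> 0\<close> it agrees with the integral truncated at \<open>y\<close>.\<close>

lemma exponential_antiderivative:
  fixes F :: "real \<Rightarrow> real"
  assumes cont: "continuous_on UNIV F" and bound: "\<And>x. \<bar>F x\<bar> \<le> B"
  shows "\<exists>\<Phi>. (\<forall>x. DERIV \<Phi> x :> F x * exp (- x)) \<and> \<Phi> 0 = 0 \<and>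
    (\<Phi> \<longlongrightarrow> (\<integral>x. F x \<partial>density lborel (exponential_density 1))) at_top"
proof -
  let ?E = "density lborel (exponential_density 1)"
  interpret E: prob_space ?E by (rule prob_space_exponential_density) simp
  have F[measurable]: "F \<in> borel_measurable borel"
    using cont by (rule borel_measurable_continuous_onI)
  have cont': "isCont (\<lambda>x. F x * exp (- x)) x" for x
    using cont by (auto simp: continuous_on_eq_continuous_at intro!: continuous_intros)
  obtain A where "\<And>x. ((A :: real \<Rightarrow> real) has_vector_derivative F x * exp (- x)) (at x)"
    using einterval_antiderivative[of "-\<infinity>" "\<infinity>" "\<lambda>x. F x * exp (- x)"] cont' by auto
  then have A: "DERIV A x :> F x * exp (- x)" for x
    by (simp add: has_real_derivative_iff_has_vector_derivative)
  define \<Phi> where "\<Phi> x = A x - A 0" for x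
  have \<Phi>: "DERIV \<Phi> x :> F x * exp (- x)" for x
    unfolding \<Phi>_def using DERIV_diff[OF A[of x] DERIV_const[of "A 0"]] by simp
  have "integrable ?E F"
    using bound by (intro integrable_bounded E.finite_measure_axioms) auto
  then have lim: "((\<lambda>y. \<integral>x. indicator {..y} x *\<^sub>R F x \<partial>?E) \<longlongrightarrow> (\<integral>x. F x \<partial>?E)) at_top"
    by (intro tendsto_integral_at_top) auto
  have "(\<integral>x. indicator {..y} x *\<^sub>R F x \<partial>?E) = \<Phi> y" if "y \<ge> 0" for y
  proof -
    have "(\<integral>x. indicator {..y} x *\<^sub>R F x \<partial>?E) = (\<integral>x. (F x * exp (- x)) * indicator {0..y} x \<partial>lborel)"
      by (subst integral_density)
        (auto simp: exponential_density_def indicator_def intro!: Bochner_Integration.integral_cong)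
    also have "\<dots> = \<Phi> y - \<Phi> 0"
      by (rule integral_FTC_Icc_real[OF that \<Phi> cont'])
    finally show ?thesis by (simp add: \<Phi>_def)
  qed
  then have "(\<Phi> \<longlongrightarrow> (\<integral>x. F x \<partial>?E)) at_top"
    by (intro Lim_transform_eventually[OF lim])
      (auto simp: eventually_at_top_linorder intro!: exI[of _ 0])
  then show ?thesis using \<Phi> by (intro exI[of _ \<Phi>]) (simp add: \<Phi>_def)
qed

lemma exponential_transport_pos:
  fixes F G :: "real \<Rightarrow> real"
  assumes "continuous_on UNIV F" "continuous_on UNIV G"
    and F: "\<And>x. 0 < F x" "\<And>x. F x \<le> B" and G: "\<And>x. 0 < G x" "\<And>x. G x \<le> B"
    and le: "\<And>x y. F x * G y \<le> exp ((sqrt (1 + (x - y)\<^sup>2) - 1) / 10)"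
  shows "(\<integral>x. F x \<partial>density lborel (exponential_density 1)) *
    (\<integral>x. G x \<partial>density lborel (exponential_density 1)) \<le> 1"
proof -
  obtain \<Phi> where \<Phi>: "\<And>x. DERIV \<Phi> x :> F x * exp (- x)" "\<Phi> 0 = 0"
    "(\<Phi> \<longlongrightarrow> (\<integral>x. F x \<partial>density lborel (exponential_density 1))) at_top"
    using exponential_antiderivative[OF assms(1), of B] F by (auto simp: abs_of_pos)
  obtain \<Gamma> where \<Gamma>: "\<And>x. DERIV \<Gamma> x :> G x * exp (- x)" "\<Gamma> 0 = 0"
    "(\<Gamma> \<longlongrightarrow> (\<integral>x. G x \<partial>density lborel (exponential_density 1))) at_top"
    using exponential_antiderivative[OF assms(2), of B] G by (auto simp: abs_of_pos)
  show ?thesis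
  proof (rule transport_core[OF \<Phi>(1) \<Gamma>(1) _ _ \<Phi>(2) \<Gamma>(2) \<Phi>(3) \<Gamma>(3)])
    fix x y :: real
    have "F x * exp (- x) * (G y * exp (- y)) = F x * G y * exp (- x - y)"
      by (simp add: exp_diff exp_minus field_simps)
    also have "\<dots> \<le> exp ((sqrt (1 + (x - y)\<^sup>2) - 1) / 10) * exp (- x - y)"
      using le by (intro mult_right_mono) auto
    also have "\<dots> = exp ((sqrt (1 + (x - y)\<^sup>2) - 1) / 10 - x - y)"
      by (simp flip: exp_add)
    finally show "F x * exp (- x) * (G y * exp (- y)) \<le> exp ((sqrt (1 + (x - y)\<^sup>2) - 1) / 10 - x - y)" .
  qed (use F G in auto)
qed

text \<open>Zeros are allowed by adding \<open>\<epsilon>\<close> to both functions, renormalising,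
  and letting \<open>\<epsilon>\<close> tend to 0.\<close>

lemma exponential_transport:
  fixes F G :: "real \<Rightarrow> real"
  assumes cont: "continuous_on UNIV F" "continuous_on UNIV G"
    and F: "\<And>x. 0 \<le> F x" "\<And>x. F x \<le> B" and G: "\<And>x. 0 \<le> G x" "\<And>x. G x \<le> B"
    and le: "\<And>x y. F x * G y \<le> exp ((sqrt (1 + (x - y)\<^sup>2) - 1) / 10)"
  shows "(\<integral>x. F x \<partial>density lborel (exponential_density 1)) *
    (\<integral>x. G x \<partial>density lborel (exponential_density 1)) \<le> 1"
proof -
  let ?E = "density lborel (exponential_density 1)"
  interpret E: prob_space ?E by (rule prob_space_exponential_density) simp
  have [measurable]: "F \<in> borel_measurable borel" "G \<in> borel_measurable borel"
    using cont by (auto intro: borel_measurable_continuous_onI)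
  have int: "integrable ?E F" "integrable ?E G"
    using F G by (auto intro!: integrable_bounded[of _ _ B] E.finite_measure_axioms)
  have B: "B \<ge> 0" using F[of 0] by linarith
  let ?I = "\<integral>x. F x \<partial>?E" and ?J = "\<integral>x. G x \<partial>?E"
  have *: "?I * ?J \<le> 1 + \<epsilon> * (2 * B + \<epsilon>)" if \<epsilon>: "\<epsilon> > 0" for \<epsilon> :: real
  proof -
    \<comment> \<open>Absorbs the cross terms, which are at most
      \<open>\<epsilon> * (2 * B + \<epsilon>)\<close>, because the exponential of the cost is at
      least 1.\<close>
    let ?K = "1 + \<epsilon> * (2 * B + \<epsilon>)"
    have K: "?K \<ge> 1" using \<epsilon> B by simp
    have "(\<integral>x. (F x + \<epsilon>) / ?K \<partial>?E) * (\<integral>x. G x + \<epsilon> \<partial>?E) \<le> 1"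
    proof (rule exponential_transport_pos[where B = "B + \<epsilon>"])
      fix x y :: real
      have "F x * \<epsilon> + \<epsilon> * G y \<le> B * \<epsilon> + \<epsilon> * B"
        using F(2)[of x] G[of y] \<epsilon> B by (intro add_mono mult_mono) auto
      then have "(F x + \<epsilon>) * (G y + \<epsilon>) \<le> F x * G y + \<epsilon> * (2 * B + \<epsilon>)"
        by (simp add: algebra_simps)
      also have "\<dots> \<le> exp ((sqrt (1 + (x - y)\<^sup>2) - 1) / 10) + \<epsilon> * (2 * B + \<epsilon>) * exp ((sqrt (1 + (x - y)\<^sup>2) - 1) / 10)"
        using add_mono[OF le[of x y] mult_left_mono[of 1 "exp ((sqrt (1 + (x - y)\<^sup>2) - 1) / 10)" "\<epsilon> * (2 * B + \<epsilon>)"]] \<epsilon> B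
        by simp
      finally show "(F x + \<epsilon>) / ?K * (G y + \<epsilon>) \<le> exp ((sqrt (1 + (x - y)\<^sup>2) - 1) / 10)"
        using K by (simp add: field_simps)
      have "(F x + \<epsilon>) / ?K \<le> F x + \<epsilon>" using K F(1)[of x] \<epsilon> by (simp add: divide_le_eq mult_le_cancel_left1)
      then show "(F x + \<epsilon>) / ?K \<le> B + \<epsilon>" using F(2)[of x] by linarith
      show "0 < (F x + \<epsilon>) / ?K" using F(1)[of x] \<epsilon> K by (intro divide_pos_pos) linarith+
      show "0 < G x + \<epsilon>" "G x + \<epsilon> \<le> B + \<epsilon>" using G[of x] \<epsilon> by auto
    qed (use cont K in \<open>auto intro!: continuous_intros\<close>)
    also have "(\<integral>x. (F x + \<epsilon>) / ?K \<partial>?E) * (\<integral>x. G x + \<epsilon> \<partial>?E) = (?I + \<epsilon>) * (?J + \<epsilon>) / ?K"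
      using int E.prob_space by simp
    finally have "(?I + \<epsilon>) * (?J + \<epsilon>) \<le> ?K" using K by (simp add: divide_le_eq)
    moreover have "?I * ?J \<le> (?I + \<epsilon>) * (?J + \<epsilon>)"
      using F G \<epsilon> by (intro mult_mono) (auto intro!: integral_nonneg)
    ultimately show ?thesis by linarith
  qed
  have "((\<lambda>\<epsilon>. 1 + \<epsilon> * (2 * B + \<epsilon>)) \<longlongrightarrow> 1 + 0 * (2 * B + 0)) (at_right 0)"
    by (intro tendsto_intros)
  then show ?thesis
    using * by (intro tendsto_lowerbound[of _ 1 "at_right 0"]) (auto simp: eventually_at_filter)
qed

text \<open>Triangle inequality in the plane for the vectors (1, p) and (1, -q), whose sum is (2, p
  - q). It bounds the Laplace cost by two exponential costs.\<close>

lemma sqrt_minkowski: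
  fixes p q :: real
  shows "sqrt (4 + (p - q)\<^sup>2) \<le> sqrt (1 + p\<^sup>2) + sqrt (1 + q\<^sup>2)"
proof (rule real_le_lsqrt)
  have "(1 - p * q)\<^sup>2 \<le> (1 + p\<^sup>2) * (1 + q\<^sup>2)"
    using zero_le_power2[of "p + q"] by (simp add: power2_eq_square algebra_simps)
  then have "1 - p * q \<le> sqrt ((1 + p\<^sup>2) * (1 + q\<^sup>2))" by (rule real_le_rsqrt)
  then show "4 + (p - q)\<^sup>2 \<le> (sqrt (1 + p\<^sup>2) + sqrt (1 + q\<^sup>2))\<^sup>2"
    by (simp add: power2_sum power2_diff real_sqrt_mult)
qed simp

subsection \<open>The Laplace distribution\<close>

definition laplace_measure :: "real measure" where
  "laplace_measure = density lborel laplace_density"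

lemma laplace_density_measurable[measurable]: "laplace_density \<in> borel_measurable borel"
  unfolding laplace_density_def by measurable

lemma sets_laplace_measure[measurable_cong, simp]: "sets laplace_measure = sets borel"
  by (simp add: laplace_measure_def)

lemma space_laplace_measure[simp]: "space laplace_measure = UNIV"
  by (simp add: laplace_measure_def)

text \<open>The left side is the density at \<open>s\<close> of a difference of two independent unit
  exponentials; the integrand is \<open>exp (- s - 2 * b)\<close> where
  \<open>b \<ge> max 0 (- s)\<close> and 0 elsewhere.\<close>

lemma exponential_convolution_integral:
  fixes s :: real
  shows "(\<integral>\<^sup>+b. ennreal (exponential_density 1 (b + s)) * ennreal (exponential_density 1 b) \<partial>lborel)
    = laplace_density s"
proof -
  let ?m = "max 0 (- s)"
  have "(\<integral>\<^sup>+b. ennreal (exponential_density 1 (b + s)) * ennreal (exponential_density 1 b) \<partial>lborel)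
     = (\<integral>\<^sup>+b. ennreal (exp (- s - 2 * b)) * indicator {?m..} b \<partial>lborel)"
    by (rule nn_integral_cong)
      (auto simp: exponential_density_def indicator_def ennreal_mult[symmetric] exp_add[symmetric] max_def
        split: if_splits)
  also have "\<dots> = ennreal (0 - (- exp (- s - 2 * ?m) / 2))"
  proof (rule nn_integral_FTC_atLeast)
    fix x :: real
    show "((\<lambda>b. - exp (- s - 2 * b) / 2) has_real_derivative exp (- s - 2 * x)) (at x)"
      by (auto intro!: derivative_eq_intros)
    have "((\<lambda>b. exp (- s - 2 * b)) \<longlongrightarrow> 0) at_top"
    proof (rule filterlim_compose[OF exp_at_bot])
      show "filterlim (\<lambda>b. - s - 2 * b) at_bot at_top"
        unfolding filterlim_at_bot eventually_at_top_linorder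
      proof (intro allI exI impI)
        fix Z b :: real assume "(- s - Z) / 2 \<le> b"
        then show "- s - 2 * b \<le> Z" by (simp add: field_simps)
      qed
    qed
    then show "((\<lambda>b. - exp (- s - 2 * b) / 2) \<longlongrightarrow> 0) at_top"
      using tendsto_minus[OF tendsto_divide[OF _ tendsto_const[of 2]], of _ 0] by fastforce
  qed auto
  also have "- s - 2 * ?m = - \<bar>s\<bar>" by (auto simp: max_def)
  finally show ?thesis by (simp add: laplace_density_def)
qed

text \<open>The substitution \<open>a = b + s\<close> and Fubini reduce the double integral to the
  convolution of the two densities.\<close>

lemma nn_integral_laplace:
  assumes f[measurable]: "f \<in> borel_measurable borel"
  shows "(\<integral>\<^sup>+b. (\<integral>\<^sup>+a. f (a - b) \<partial>density lborel (exponential_density 1)) \<partial>density lborel (exponential_density 1))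
    = (\<integral>\<^sup>+s. f s \<partial>laplace_measure)"
proof -
  let ?e = "\<lambda>x. ennreal (exponential_density 1 x)"
  have "(\<integral>\<^sup>+b. (\<integral>\<^sup>+a. f (a - b) \<partial>density lborel ?e) \<partial>density lborel ?e)
     = (\<integral>\<^sup>+b. ?e b * (\<integral>\<^sup>+a. ?e a * f (a - b) \<partial>lborel) \<partial>lborel)"
    by (simp add: nn_integral_density)
  also have "\<dots> = (\<integral>\<^sup>+b. (\<integral>\<^sup>+s. (?e (b + s) * ?e b) * f s \<partial>lborel) \<partial>lborel)"
  proof (rule nn_integral_cong)
    fix b :: real
    have "(\<integral>\<^sup>+a. ?e a * f (a - b) \<partial>lborel) = (\<integral>\<^sup>+s. ?e (b + s) * f s \<partial>lborel)"
      by (subst nn_integral_real_affine[where c = 1 and t = b]) auto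
    then show "?e b * (\<integral>\<^sup>+a. ?e a * f (a - b) \<partial>lborel) = (\<integral>\<^sup>+s. (?e (b + s) * ?e b) * f s \<partial>lborel)"
      by (simp add: nn_integral_cmult[symmetric] mult_ac)
  qed
  also have "\<dots> = (\<integral>\<^sup>+s. (\<integral>\<^sup>+b. (?e (b + s) * ?e b) * f s \<partial>lborel) \<partial>lborel)"
    by (rule lborel_pair.Fubini') measurable
  also have "\<dots> = (\<integral>\<^sup>+s. laplace_density s * f s \<partial>lborel)"
    by (simp add: nn_integral_multc exponential_convolution_integral)
  also have "\<dots> = (\<integral>\<^sup>+s. f s \<partial>laplace_measure)"
    by (simp add: laplace_measure_def nn_integral_density)
  finally show ?thesis .
qed

lemma prob_space_laplace: "prob_space laplace_measure"
proof
  interpret E: prob_space "density lborel (exponential_density 1)"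
    by (rule prob_space_exponential_density) simp
  show "emeasure laplace_measure (space laplace_measure) = 1"
    using nn_integral_laplace[of "\<lambda>_. 1"] E.emeasure_space_1 by simp
qed

lemma integral_laplace:
  fixes F :: "real \<Rightarrow> real"
  assumes F[measurable]: "F \<in> borel_measurable borel" and F0: "\<And>x. 0 \<le> F x" and FB: "\<And>x. F x \<le> B"
  shows "(\<integral>b. (\<integral>a. F (a - b) \<partial>density lborel (exponential_density 1)) \<partial>density lborel (exponential_density 1))
    = (\<integral>s. F s \<partial>laplace_measure)"
proof -
  let ?E = "density lborel (exponential_density 1)"
  interpret E: prob_space ?E by (rule prob_space_exponential_density) simp
  interpret L: prob_space laplace_measure by (rule prob_space_laplace)
  have B: "B \<ge> 0" using F0[of 0] FB[of 0] by linarith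
  have inner: "integrable ?E (\<lambda>a. F (a - b))" for b
    using F0 FB by (auto intro!: integrable_bounded[of _ _ B] E.finite_measure_axioms)
  have inner0: "0 \<le> (\<integral>a. F (a - b) \<partial>?E)" for b
    using F0 by simp
  have [measurable]: "(\<lambda>b. \<integral>a. F (a - b) \<partial>?E) \<in> borel_measurable borel"
    using E.borel_measurable_lebesgue_integral[of "\<lambda>b a. F (a - b)" borel] by simp
  have "(\<integral>a. F (a - b) \<partial>?E) \<le> B" for b
    using integral_mono[OF inner[of b] E.integrable_const[of B]] FB E.prob_space by simp
  then have outer: "integrable ?E (\<lambda>b. \<integral>a. F (a - b) \<partial>?E)"
    using inner0 by (auto intro!: integrable_bounded[of _ _ B] E.finite_measure_axioms)
  have "ennreal (\<integral>b. (\<integral>a. F (a - b) \<partial>?E) \<partial>?E) = (\<integral>\<^sup>+b. (\<integral>\<^sup>+a. ennreal (F (a - b)) \<partial>?E) \<partial>?E)"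
    using inner0 F0 by (simp add: nn_integral_eq_integral[OF outer] nn_integral_eq_integral[OF inner])
  also have "\<dots> = (\<integral>\<^sup>+s. ennreal (F s) \<partial>laplace_measure)"
    by (rule nn_integral_laplace) measurable
  also have "\<dots> = ennreal (\<integral>s. F s \<partial>laplace_measure)"
    using F0 FB
    by (intro nn_integral_eq_integral) (auto intro!: integrable_bounded[of _ _ B] L.finite_measure_axioms)
  finally show ?thesis using F0 inner0 by (simp add: integral_nonneg)
qed

text \<open>The infimal convolution of the exponential cost
  \<open>(sqrt (1 + s\<^sup>2) - 1) / 10\<close> with itself, attained by splitting \<open>s\<close>
  into halves. It is quadratic near 0 and linear at infinity.\<close>

definition laplace_cost :: "real \<Rightarrow> real" where
  "laplace_cost s = (sqrt (4 + s\<^sup>2) - 2) / 10"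

lemma laplace_cost_nonneg: "0 \<le> laplace_cost s"
proof -
  have "2 \<le> sqrt (4 + s\<^sup>2)" by (rule real_le_rsqrt) simp
  then show ?thesis by (simp add: laplace_cost_def)
qed

text \<open>The exponential inequality is applied twice to \<open>F (a - b)\<close> and
  \<open>G (a' - b')\<close>: first in \<open>a\<close> and \<open>a'\<close>, then to the resulting
  partial integrals as functions of \<open>b\<close> and \<open>b'\<close>.\<close>

lemma laplace_transport:
  fixes F G :: "real \<Rightarrow> real"
  assumes cont: "continuous_on UNIV F" "continuous_on UNIV G"
    and F: "\<And>x. 0 \<le> F x" "\<And>x. F x \<le> B" and G: "\<And>x. 0 \<le> G x" "\<And>x. G x \<le> B"
    and le: "\<And>x y. F x * G y \<le> exp (laplace_cost (x - y))"
  shows "(\<integral>x. F x \<partial>laplace_measure) * (\<integral>x. G x \<partial>laplace_measure) \<le> 1"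
proof -
  let ?E = "density lborel (exponential_density 1)"
  interpret E: prob_space ?E by (rule prob_space_exponential_density) simp
  have [measurable]: "F \<in> borel_measurable borel" "G \<in> borel_measurable borel"
    using cont by (auto intro: borel_measurable_continuous_onI)
  have B: "B \<ge> 0" using F[of 0] by linarith
  have conv: "continuous_on UNIV (\<lambda>b. \<integral>a. H (a - b) \<partial>?E)" "0 \<le> (\<integral>a. H (a - b) \<partial>?E)" "(\<integral>a. H (a - b) \<partial>?E) \<le> B"
    if H: "continuous_on UNIV H" "\<And>x. 0 \<le> H x" "\<And>x. H x \<le> B" for H :: "real \<Rightarrow> real" and b
  proof -
    have [measurable]: "H \<in> borel_measurable borel"
      using H by (auto intro: borel_measurable_continuous_onI)
    show "continuous_on UNIV (\<lambda>b. \<integral>a. H (a - b) \<partial>?E)"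
      using H by (intro continuous_on_integral_bounded[where B = B] E.finite_measure_axioms)
        (auto intro!: continuous_on_compose2[OF H(1)] continuous_intros)
    show "0 \<le> (\<integral>a. H (a - b) \<partial>?E)" using H by simp
    have "integrable ?E (\<lambda>a. H (a - b))"
      using H by (auto intro!: integrable_bounded[of _ _ B] E.finite_measure_axioms)
    from integral_mono[OF this E.integrable_const[of B]] show "(\<integral>a. H (a - b) \<partial>?E) \<le> B"
      using H E.prob_space by simp
  qed
  have "(\<integral>b. (\<integral>a. F (a - b) \<partial>?E) \<partial>?E) * (\<integral>b. (\<integral>a. G (a - b) \<partial>?E) \<partial>?E) \<le> 1"
  proof (rule exponential_transport[where B = B])
    fix b b' :: real
    let ?c = "(sqrt (1 + (b - b')\<^sup>2) - 1) / 10"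
    have c: "?c \<ge> 0" by simp
    \<comment> \<open>With \<open>b\<close> and \<open>b'\<close> frozen, their share
      \<open>?c\<close> of the cost is a constant; it is divided out here and returns as the bound
      for the outer application.\<close>
    have "(\<integral>a. F (a - b) / exp ?c \<partial>?E) * (\<integral>a. G (a - b') \<partial>?E) \<le> 1"
    proof (rule exponential_transport[where B = B])
      fix a a' :: real
      have "F (a - b) * G (a' - b') \<le> exp (laplace_cost ((a - a') - (b - b')))"
        using le[of "a - b" "a' - b'"] by (simp add: algebra_simps)
      also have "\<dots> \<le> exp ((sqrt (1 + (a - a')\<^sup>2) - 1) / 10 + ?c)"
      proof -
        have "(m - 2) / 10 \<le> (u - 1) / 10 + (v - 1) / 10" if "m \<le> u + v" for m u v :: real
          using that by (simp add: field_simps)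
        then show ?thesis
          using sqrt_minkowski[of "a - a'" "b - b'"] unfolding laplace_cost_def exp_le_cancel_iff by blast
      qed
      finally show "F (a - b) / exp ?c * G (a' - b') \<le> exp ((sqrt (1 + (a - a')\<^sup>2) - 1) / 10)"
        by (simp add: divide_le_eq exp_add)
      have "F (a - b) / exp ?c \<le> F (a - b)"
        using c F(1)[of "a - b"] by (simp add: divide_le_eq mult_le_cancel_left1 del: divide_le_eq_numeral1)
      then show "F (a - b) / exp ?c \<le> B" using F(2)[of "a - b"] by linarith
    qed (use F G cont in \<open>auto intro!: continuous_intros continuous_on_compose2[OF cont(1)] continuous_on_compose2[OF cont(2)]\<close>)
    then show "(\<integral>a. F (a - b) \<partial>?E) * (\<integral>a. G (a - b') \<partial>?E) \<le> exp ?c"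
      by (simp add: divide_le_eq)
  qed (use conv F G cont in auto)
  then show ?thesis using integral_laplace[of F B] integral_laplace[of G B] F G by simp
qed

subsection \<open>Product measures\<close>

text \<open>Tensorisation: one coordinate is integrated out while the cost of the others is a
  constant, then the induction hypothesis is applied to the slices. Continuity is asked
  coordinatewise, a form that slicing preserves.\<close>

lemma laplace_transport_PiM:
  fixes F G :: "('i \<Rightarrow> real) \<Rightarrow> real"
  assumes "finite I"
    and "F \<in> borel_measurable (PiM I (\<lambda>_. laplace_measure))" "G \<in> borel_measurable (PiM I (\<lambda>_. laplace_measure))"
    and "\<And>x i. continuous_on UNIV (\<lambda>t. F (x(i := t)))" "\<And>x i. continuous_on UNIV (\<lambda>t. G (x(i := t)))"
    and "\<And>x. 0 \<le> F x" "\<And>x. F x \<le> B" and "\<And>x. 0 \<le> G x" "\<And>x. G x \<le> B"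
    and "\<And>x y. F x * G y \<le> exp (\<Sum>i\<in>I. laplace_cost (x i - y i))"
  shows "(\<integral>x. F x \<partial>PiM I (\<lambda>_. laplace_measure)) * (\<integral>x. G x \<partial>PiM I (\<lambda>_. laplace_measure)) \<le> 1"
  using assms
proof (induction I arbitrary: F G rule: finite_induct)
  case empty
  then show ?case by (simp add: lebesgue_integral_count_space_finite PiM_empty)
next
  case (insert i I)
  interpret L: prob_space laplace_measure by (rule prob_space_laplace)
  interpret product_sigma_finite "\<lambda>_. laplace_measure" by unfold_locales
  let ?P = "PiM I (\<lambda>_. laplace_measure)"
  interpret P: prob_space ?P by (intro prob_space_PiM prob_space_laplace)
  interpret P': prob_space "PiM (insert i I) (\<lambda>_. laplace_measure)"
    by (intro prob_space_PiM prob_space_laplace)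
  have B: "B \<ge> 0" using insert.prems(5,6) order_trans by blast
  \<comment> \<open>Defined for arbitrary \<open>x\<close>, because the hypotheses quantify over all
    functions and not only over points of the product space.\<close>
  define slice where "slice H x = (\<integral>t. H (x(i := t)) \<partial>laplace_measure)" for H :: "('i \<Rightarrow> real) \<Rightarrow> real" and x
  have slice: "slice H \<in> borel_measurable ?P" "\<And>x j. continuous_on UNIV (\<lambda>t. slice H (x(j := t)))"
      "\<And>x. 0 \<le> slice H x" "\<And>x. slice H x \<le> B"
      "(\<integral>x. H x \<partial>PiM (insert i I) (\<lambda>_. laplace_measure)) = (\<integral>x. slice H x \<partial>?P)"
    if [measurable]: "H \<in> borel_measurable (PiM (insert i I) (\<lambda>_. laplace_measure))"
      and H: "\<And>x i. continuous_on UNIV (\<lambda>t. H (x(i := t)))" "\<And>x. 0 \<le> H x" "\<And>x. H x \<le> B" for H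
  proof -
    have m: "(\<lambda>t. H (x(i := t))) \<in> borel_measurable laplace_measure" for x
      using borel_measurable_continuous_onI[OF H(1)] by (simp add: measurable_cong_sets[OF sets_laplace_measure refl])
    have int: "integrable laplace_measure (\<lambda>t. H (x(i := t)))" for x
      using H m by (auto intro!: integrable_bounded[of _ _ B] L.finite_measure_axioms)
    show "slice H \<in> borel_measurable ?P"
      unfolding slice_def by measurable
    show "0 \<le> slice H x" for x unfolding slice_def using H by simp
    show "slice H x \<le> B" for x
      using integral_mono[OF int[of x] L.integrable_const[of B]] H L.prob_space by (simp add: slice_def)
    show "continuous_on UNIV (\<lambda>t. slice H (x(j := t)))" for x j
    \<comment> \<open>Overwriting coordinate \<open>i\<close> leaves a slice unchanged; dominated
      convergence handles the other coordinates.\<close>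
    proof (cases "j = i")
      case False
      show ?thesis unfolding slice_def
      proof (rule continuous_on_integral_bounded[where B = B])
        show "continuous_on UNIV (\<lambda>t. H (x(j := t, i := s)))" for s
          using H(1)[of "x(i := s)" j] False by (simp add: fun_upd_twist)
      qed (use H m L.finite_measure_axioms in auto)
    qed (simp add: slice_def)
    show "(\<integral>x. H x \<partial>PiM (insert i I) (\<lambda>_. laplace_measure)) = (\<integral>x. slice H x \<partial>?P)"
      unfolding slice_def
      using H by (intro product_integral_insert insert.hyps)
        (auto intro!: integrable_bounded[of _ _ B] P'.finite_measure_axioms)
  qed
  note sF = slice[OF insert.prems(1,3,5,6)] and sG = slice[OF insert.prems(2,4,7,8)]
  have "(\<integral>x. slice F x \<partial>?P) * (\<integral>x. slice G x \<partial>?P) \<le> 1"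
  proof (rule insert.IH[OF sF(1) sG(1) sF(2) sG(2) sF(3,4) sG(3,4)])
    fix x y :: "'i \<Rightarrow> real"
    let ?c = "\<Sum>j\<in>I. laplace_cost (x j - y j)"
    have c: "?c \<ge> 0" by (intro sum_nonneg laplace_cost_nonneg)
    have "(\<integral>t. F (x(i := t)) / exp ?c \<partial>laplace_measure) * (\<integral>t. G (y(i := t)) \<partial>laplace_measure) \<le> 1"
    proof (rule laplace_transport[where B = B])
      fix s t :: real
      have "F (x(i := s)) * G (y(i := t))
          \<le> exp (\<Sum>j\<in>insert i I. laplace_cost ((x(i := s)) j - (y(i := t)) j))"
        by (rule insert.prems(9))
      also have "(\<Sum>j\<in>insert i I. laplace_cost ((x(i := s)) j - (y(i := t)) j)) = laplace_cost (s - t) + ?c"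
      proof -
        have "(\<Sum>j\<in>I. laplace_cost ((x(i := s)) j - (y(i := t)) j)) = ?c"
          using insert.hyps by (intro sum.cong) auto
        then show ?thesis using insert.hyps by simp
      qed
      finally show "F (x(i := s)) / exp ?c * G (y(i := t)) \<le> exp (laplace_cost (s - t))"
        unfolding exp_add by (simp only: times_divide_eq_left divide_le_eq exp_gt_zero if_True)
      have "F (x(i := s)) / exp ?c \<le> F (x(i := s)) / 1"
        using c insert.prems(5) by (intro divide_left_mono) auto
      then show "F (x(i := s)) / exp ?c \<le> B" by (metis div_by_1 insert.prems(6) order_trans)
    qed (use insert.prems in \<open>auto intro!: continuous_intros simp del: fun_upd_apply\<close>)
    then show "slice F x * slice G y \<le> exp ?c" by (simp add: slice_def divide_le_eq)
  qed
  then show ?case using sF(5) sG(5) by simp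
qed

lemma vec_borel_measurable:
  fixes X :: "'a \<Rightarrow> real ^ 'n"
  assumes "\<And>i. (\<lambda>\<omega>. X \<omega> $ i) \<in> borel_measurable M"
  shows "X \<in> borel_measurable M"
  using assms by (subst borel_measurable_euclidean_space) (auto simp: Basis_vec_def inner_axis)

text \<open>By independence the joint law of the coordinates is the product of Laplace measures, on
  which \<open>F\<close> and \<open>G\<close> are read through \<open>\<chi> i. x i\<close>.\<close>

lemma laplace_transport_vec:
  fixes M :: "'a measure" and X :: "'a \<Rightarrow> real ^ 'n" and F G :: "real ^ 'n \<Rightarrow> real"
  assumes "prob_space M"
    and indep: "prob_space.indep_vars M (\<lambda>_. borel) (\<lambda>i \<omega>. X \<omega> $ i) UNIV"
    and dist: "\<And>i. distributed M lborel (\<lambda>\<omega>. X \<omega> $ i) laplace_density"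
    and cont: "continuous_on UNIV F" "continuous_on UNIV G"
    and F: "\<And>x. 0 \<le> F x" "\<And>x. F x \<le> B" and G: "\<And>x. 0 \<le> G x" "\<And>x. G x \<le> B"
    and le: "\<And>x y. F x * G y \<le> exp (\<Sum>i\<in>UNIV. laplace_cost (x $ i - y $ i))"
  shows "(\<integral>\<omega>. F (X \<omega>) \<partial>M) * (\<integral>\<omega>. G (X \<omega>) \<partial>M) \<le> 1"
proof -
  interpret prob_space M by fact
  let ?P = "PiM UNIV (\<lambda>_::'n. laplace_measure)"
  have rv[measurable]: "(\<lambda>\<omega>. X \<omega> $ i) \<in> borel_measurable M" for i
    using distributed_measurable[OF dist[of i]] by simp
  have "distr M borel (\<lambda>\<omega>. X \<omega> $ i) = laplace_measure" for i
    using distributed_distr_eq_density[OF dist[of i]]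
    unfolding laplace_measure_def by (metis distr_cong sets_lborel)
  then have P: "distr M (PiM UNIV (\<lambda>_. borel)) (\<lambda>\<omega>. \<lambda>i\<in>UNIV. X \<omega> $ i) = ?P"
    using indep_vars_iff_distr_eq_PiM[where I = UNIV and M' = "\<lambda>_. borel" and X = "\<lambda>i \<omega>. X \<omega> $ i"]
      indep by simp
  have rvP: "(\<lambda>\<omega>. \<lambda>i\<in>UNIV. X \<omega> $ i) \<in> measurable M (PiM UNIV (\<lambda>_. borel))"
    by (rule measurable_restrict) (rule rv)
  have vec: "(\<lambda>x. \<chi> i. x i) \<in> borel_measurable (PiM UNIV (\<lambda>_::'n. borel :: real measure))"
    by (rule vec_borel_measurable) simp
  have transfer: "(\<integral>\<omega>. H (X \<omega>) \<partial>M) = (\<integral>x. H (\<chi> i. x i) \<partial>?P)" "(\<lambda>x. H (\<chi> i. x i)) \<in> borel_measurable ?P"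
    "continuous_on UNIV (\<lambda>t. H (\<chi> j. (x(i := t)) j))"
    if H: "continuous_on UNIV H" for H :: "real ^ 'n \<Rightarrow> real" and x i
  proof -
    have H': "(\<lambda>x. H (\<chi> i. x i)) \<in> borel_measurable (PiM UNIV (\<lambda>_. borel))"
      using measurable_compose[OF vec borel_measurable_continuous_onI[OF H]] .
    show "(\<integral>\<omega>. H (X \<omega>) \<partial>M) = (\<integral>x. H (\<chi> i. x i) \<partial>?P)"
      unfolding P[symmetric] by (subst integral_distr[OF rvP H']) (simp add: restrict_def)
    show "(\<lambda>x. H (\<chi> i. x i)) \<in> borel_measurable ?P"
      using H' by (simp add: P[symmetric])
    have "continuous_on UNIV (\<lambda>t. \<chi> j. (x(i := t)) j)"
    proof (rule continuous_on_vec_lambda)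
      show "continuous_on UNIV (\<lambda>t. (x(i := t)) j)" for j
        by (cases "j = i") auto
    qed
    then show "continuous_on UNIV (\<lambda>t. H (\<chi> j. (x(i := t)) j))"
      by (rule continuous_on_compose2[OF H]) auto
  qed
  have "F (\<chi> i. x i) * G (\<chi> i. y i) \<le> exp (\<Sum>i\<in>UNIV. laplace_cost (x i - y i))" for x y
    using le[of "\<chi> i. x i" "\<chi> i. y i"] by simp
  then show ?thesis
    unfolding transfer(1)[OF cont(1)] transfer(1)[OF cont(2)]
    using F G
    by (intro laplace_transport_PiM[where B = B]) (auto intro!: transfer cont simp del: fun_upd_apply)
qed

subsection \<open>Normalisation onto the cross-polytope boundary\<close>

definition l1_norm :: "real ^ 'n \<Rightarrow> real" where
  "l1_norm x = (\<Sum>i\<in>UNIV. \<bar>x $ i\<bar>)"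

lemma l1_norm_nonneg: "0 \<le> l1_norm x"
  by (simp add: l1_norm_def sum_nonneg)

lemma l1_norm_eq_0_iff: "l1_norm x = 0 \<longleftrightarrow> x = 0"
  by (simp add: l1_norm_def sum_nonneg_eq_0_iff vec_eq_iff)

lemma l1_norm_0 [simp]: "l1_norm 0 = 0"
  by (simp add: l1_norm_def)

lemma l1_norm_diff_le: "\<bar>l1_norm y - l1_norm x\<bar> \<le> l1_norm (x - y)"
proof -
  have "\<bar>l1_norm y - l1_norm x\<bar> = \<bar>\<Sum>i\<in>UNIV. \<bar>y $ i\<bar> - \<bar>x $ i\<bar>\<bar>"
    by (simp add: l1_norm_def sum_subtractf)
  also have "\<dots> \<le> (\<Sum>i\<in>UNIV. \<bar>\<bar>y $ i\<bar> - \<bar>x $ i\<bar>\<bar>)" by (rule sum_abs)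
  also have "\<dots> \<le> l1_norm (x - y)"
    unfolding l1_norm_def by (rule sum_mono) auto
  finally show ?thesis .
qed

text \<open>Cauchy-Schwarz against the all-ones vector.\<close>

lemma l1_norm_le_norm:
  fixes x :: "real ^ 'n"
  shows "l1_norm x \<le> sqrt CARD('n) * norm x"
  using L2_set_mult_ineq[of "\<lambda>i. x $ i" "\<lambda>_. 1" UNIV]
  by (simp add: l1_norm_def norm_vec_def L2_set_def mult.commute)

lemma normalize_in_l1_sphere: "x \<noteq> 0 \<Longrightarrow> (1 / l1_norm x) *\<^sub>R x \<in> l1_sphere"
  using l1_norm_eq_0_iff[of x] l1_norm_nonneg[of x]
  by (simp add: l1_sphere_def l1_norm_def abs_mult sum_distrib_left[symmetric] sum_divide_distrib[symmetric])

lemma norm_le_1_l1_sphere: "u \<in> l1_sphere \<Longrightarrow> norm u \<le> 1"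
  using norm_le_l1_cart[of u] by (simp add: l1_sphere_def)

text \<open>With \<open>g i = 10 * laplace_cost (x $ i)\<close> one has
  \<open>(x $ i)\<^sup>2 = (g i)\<^sup>2 + 4 * g i\<close>; sum and complete the square. The
  additive 2 pays for the quadratic behaviour of the cost near 0.\<close>

lemma norm_le_sum_laplace_cost:
  fixes x :: "real ^ 'n"
  shows "norm x \<le> 10 * (\<Sum>i\<in>UNIV. laplace_cost (x $ i)) + 2"
proof -
  define g where "g i = sqrt (4 + (x $ i)\<^sup>2) - 2" for i
  define G where "G = (\<Sum>i\<in>UNIV. g i)"
  have g0: "g i \<ge> 0" for i using laplace_cost_nonneg[of "x $ i"] by (simp add: g_def laplace_cost_def)
  then have G0: "G \<ge> 0" by (simp add: G_def sum_nonneg)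
  have "L2_set g UNIV \<le> G" unfolding G_def using g0 by (intro L2_set_le_sum) auto
  then have "(L2_set g UNIV)\<^sup>2 \<le> G\<^sup>2" by (intro power_mono) (auto simp: L2_set_nonneg)
  then have sq: "(\<Sum>i\<in>UNIV. (g i)\<^sup>2) \<le> G\<^sup>2" by (simp add: L2_set_def sum_nonneg)
  have "(x $ i)\<^sup>2 = (g i)\<^sup>2 + 4 * g i" for i
  proof -
    have "(g i + 2)\<^sup>2 = 4 + (x $ i)\<^sup>2" by (simp add: g_def)
    then show ?thesis by (simp add: power2_eq_square algebra_simps)
  qed
  moreover have "(norm x)\<^sup>2 = (\<Sum>i\<in>UNIV. (x $ i)\<^sup>2)"
    by (simp add: norm_vec_def L2_set_def sum_nonneg)
  ultimately have "(norm x)\<^sup>2 = (\<Sum>i\<in>UNIV. (g i)\<^sup>2) + 4 * G"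
    by (simp add: G_def sum.distrib sum_distrib_left)
  also have "\<dots> \<le> (G + 2)\<^sup>2" using sq by (simp add: power2_sum)
  finally have "norm x \<le> G + 2" by (rule power2_le_imp_le) (use G0 in simp)
  also have "G = 10 * (\<Sum>i\<in>UNIV. laplace_cost (x $ i))"
  proof -
    have "g i = 10 * laplace_cost (x $ i)" for i by (simp add: g_def laplace_cost_def)
    then show ?thesis by (simp add: G_def sum_distrib_left)
  qed
  finally show ?thesis .
qed

text \<open>A line just below the tangent of slope 3/125. Summed over \<open>d\<close> coordinates
  at l1 distance \<open>d / 2\<close> it gives \<open>6/1000 * d\<close>, which is the rate
  \<open>3/1000 * d\<close> times the bound 2 on the diameter of the sphere.\<close>

lemma laplace_cost_ge_linear: "(3/125) * \<bar>t\<bar> - (3/500) \<le> laplace_cost t"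
proof -
  have "((97/50) + (6/25) * \<bar>t\<bar>)\<^sup>2 \<le> 4 + t\<^sup>2"
  proof -
    have "4 + t\<^sup>2 - ((97/50) + (6/25) * \<bar>t\<bar>)\<^sup>2 = ((97/100) * \<bar>t\<bar> - (12/25))\<^sup>2 + (3/2000) * t\<^sup>2 + (3/500)"
      by (simp add: power2_eq_square field_simps)
    moreover have "0 \<le> ((97/100) * \<bar>t\<bar> - (12/25))\<^sup>2" "0 \<le> t\<^sup>2" by simp_all
    ultimately show ?thesis by linarith
  qed
  then have "(97/50) + (6/25) * \<bar>t\<bar> \<le> sqrt (4 + t\<^sup>2)" by (rule real_le_rsqrt)
  then show ?thesis by (simp add: laplace_cost_def field_simps)
qed

text \<open>Links the Lipschitz bound to the transport cost. Typicality is asked of \<open>y\<close>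
  alone, so that the cutoff will multiply only one of the two functions; the constant 13/100 stems
  from the additive 2 in \<open>norm_le_sum_laplace_cost\<close>.\<close>

lemma lipschitz_normalize_cost:
  fixes x y :: "real ^ 'n" and f :: "real ^ 'n \<Rightarrow> real"
  defines "d \<equiv> real CARD('n)"
  assumes lip: "1-lipschitz_on l1_sphere f"
    and x: "x \<noteq> 0" and y1: "(7/10) * d \<le> l1_norm y" and y2: "(norm y)\<^sup>2 \<le> 5 * d"
  shows "(3/1000) * d * \<bar>f ((1 / l1_norm x) *\<^sub>R x) - f ((1 / l1_norm y) *\<^sub>R y)\<bar>
    \<le> (13/100) + (\<Sum>i\<in>UNIV. laplace_cost (x $ i - y $ i))"
proof -
  define u v where "u = (1 / l1_norm x) *\<^sub>R x" and "v = (1 / l1_norm y) *\<^sub>R y"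
  define W where "W = (\<Sum>i\<in>UNIV. laplace_cost (x $ i - y $ i))"
  define N where "N = norm (x - y)"
  have d: "d > 0" by (simp add: d_def)
  have Sy: "l1_norm y > 0" using y1 d by linarith
  then have "y \<noteq> 0" using l1_norm_eq_0_iff[of y] by auto
  have Sx: "l1_norm x > 0" using l1_norm_eq_0_iff[of x] l1_norm_nonneg[of x] x by linarith
  have uv: "u \<in> l1_sphere" "v \<in> l1_sphere"
    unfolding u_def v_def using x \<open>y \<noteq> 0\<close> by (auto intro: normalize_in_l1_sphere)
  have fuv: "\<bar>f u - f v\<bar> \<le> norm (u - v)"
    using lipschitz_onD[OF lip uv] by (simp add: dist_norm)
  have "(3/1000) * d * norm (u - v) \<le> (13/100) + W"
  \<comment> \<open>Far apart, the cost alone beats the diameter 2 of the sphere; otherwise \<open>l1_norm x\<close> is also of order \<open>d\<close>.\<close>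
  proof (cases "l1_norm (x - y) \<ge> d / 2")
    case True
    have "norm (u - v) \<le> 2"
      using norm_triangle_ineq4[of u v] norm_le_1_l1_sphere[OF uv(1)] norm_le_1_l1_sphere[OF uv(2)] by linarith
    then have "(3/1000) * d * norm (u - v) \<le> (3/1000) * d * 2" using d by (intro mult_left_mono) auto
    also have "\<dots> \<le> (3/125) * l1_norm (x - y) - (3/500) * d" using True by (simp add: field_simps)
    also have "\<dots> = (\<Sum>i\<in>UNIV. (3/125) * \<bar>x $ i - y $ i\<bar> - (3/500))"
      by (simp add: l1_norm_def sum_subtractf sum_distrib_left d_def)
    also have "\<dots> \<le> W" unfolding W_def by (intro sum_mono laplace_cost_ge_linear)
    finally show ?thesis by simp
  next
    case False
    have diff: "\<bar>l1_norm y - l1_norm x\<bar> \<le> l1_norm (x - y)" by (rule l1_norm_diff_le)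
    then have Sx': "(1/5) * d \<le> l1_norm x" using False y1 by linarith
    have "l1_norm x *\<^sub>R u = x" "l1_norm y *\<^sub>R v = y"
      unfolding u_def v_def using Sx Sy by simp_all
    \<comment> \<open>Splits the displacement into a Euclidean and a radial part. The radial factor
      is at most \<open>sqrt d * N\<close>, and \<open>norm v\<close> is at most of order
      \<open>1 / sqrt d\<close>, so both parts are of order \<open>N\<close>.\<close>
    then have eq: "l1_norm x *\<^sub>R (u - v) = (x - y) + (l1_norm y - l1_norm x) *\<^sub>R v"
      by (simp add: scaleR_diff_right scaleR_diff_left)
    \<comment> \<open>The constant 45/14 below is 9/4, a bound for \<open>sqrt 5\<close>, divided by
      7/10; adding 1 for the Euclidean part gives 59/14.\<close>
    have "norm y \<le> sqrt (5 * d)" using y2 by (intro real_le_rsqrt)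
    then have "sqrt d * norm y \<le> sqrt d * sqrt (5 * d)" using d by (intro mult_left_mono) auto
    also have "\<dots> = sqrt 5 * d" using d by (simp add: real_sqrt_mult)
    also have "\<dots> \<le> 9/4 * d" using d by (intro mult_right_mono real_le_lsqrt) (auto simp: power2_eq_square)
    also have "\<dots> \<le> 45/14 * l1_norm y" using y1 by simp
    finally have "sqrt d * norm v \<le> 45/14" using Sy by (simp add: v_def field_simps)
    then have "N * (sqrt d * norm v) \<le> N * (45/14)" by (intro mult_left_mono) (auto simp: N_def)
    moreover have "\<bar>l1_norm y - l1_norm x\<bar> * norm v \<le> (N * sqrt d) * norm v"
      using diff l1_norm_le_norm[of "x - y"] by (intro mult_right_mono) (auto simp: N_def d_def mult.commute)
    moreover have "norm ((l1_norm y - l1_norm x) *\<^sub>R v) = \<bar>l1_norm y - l1_norm x\<bar> * norm v" by simp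
    ultimately have "norm ((x - y) + (l1_norm y - l1_norm x) *\<^sub>R v) \<le> 59/14 * N"
      using norm_triangle_ineq[of "x - y" "(l1_norm y - l1_norm x) *\<^sub>R v"]
      unfolding mult.assoc N_def by linarith
    then have "l1_norm x * norm (u - v) \<le> 59/14 * N"
      unfolding eq[symmetric] using Sx by simp
    moreover have "(1/5) * d * norm (u - v) \<le> l1_norm x * norm (u - v)"
      using Sx' by (intro mult_right_mono) auto
    ultimately have "(1/5) * d * norm (u - v) \<le> 59/14 * N" by linarith
    moreover have "N \<le> 10 * W + 2" unfolding N_def W_def using norm_le_sum_laplace_cost[of "x - y"] by simp
    moreover have "W \<ge> 0" unfolding W_def by (intro sum_nonneg laplace_cost_nonneg)
    \<comment> \<open>Numerically, 3/1000 * 5 * 59/14 is below 13/200, so ten times it is below 1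
      and twice it is below 13/100.\<close>
    ultimately show ?thesis by simp
  qed
  moreover have "(3/1000) * d * \<bar>f u - f v\<bar> \<le> (3/1000) * d * norm (u - v)"
    using fuv d by (intro mult_left_mono) auto
  ultimately show ?thesis unfolding u_def v_def W_def by linarith
qed

subsection \<open>Typical points\<close>

text \<open>Under the Laplace law \<open>\<bar>s\<bar>\<close> is a unit exponential, seen by
  splitting according to sign. Both halves count at \<open>s = 0\<close>, so the pointwise
  comparison is an inequality.\<close>

lemma nn_integral_laplace_abs_le:
  fixes f :: "real \<Rightarrow> real"
  assumes [measurable]: "f \<in> borel_measurable borel"
  shows "(\<integral>\<^sup>+s. ennreal (f \<bar>s\<bar>) \<partial>laplace_measure) \<le> (\<integral>\<^sup>+x. ennreal (exponential_density 1 x * f x) \<partial>lborel)"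
proof -
  let ?e = "\<lambda>x. ennreal (exponential_density 1 x * f x)"
  have e0: "0 \<le> exponential_density 1 x" for x by (simp add: exponential_density_def)
  have "(\<integral>\<^sup>+s. ennreal (f \<bar>s\<bar>) \<partial>laplace_measure) = (\<integral>\<^sup>+s. laplace_density s * ennreal (f \<bar>s\<bar>) \<partial>lborel)"
    by (simp add: laplace_measure_def nn_integral_density)
  also have "\<dots> \<le> (\<integral>\<^sup>+s. ennreal (1/2) * ?e s + ennreal (1/2) * ?e (- s) \<partial>lborel)"
  proof (rule nn_integral_mono)
    fix s :: real
    have "laplace_density s * ennreal (f \<bar>s\<bar>) = ennreal (1/2) * ?e \<bar>s\<bar>"
    proof -
      have "laplace_density s * ennreal (f \<bar>s\<bar>) = ennreal (exp (- \<bar>s\<bar>) / 2 * f \<bar>s\<bar>)"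
        unfolding laplace_density_def by (rule ennreal_mult'[symmetric]) simp
      also have "exp (- \<bar>s\<bar>) / 2 * f \<bar>s\<bar> = 1/2 * (exponential_density 1 \<bar>s\<bar> * f \<bar>s\<bar>)"
        by (simp add: exponential_density_def)
      also have "ennreal \<dots> = ennreal (1/2) * ?e \<bar>s\<bar>" by (rule ennreal_mult') simp
      finally show ?thesis .
    qed
    also have "\<dots> \<le> ennreal (1/2) * ?e s + ennreal (1/2) * ?e (- s)"
      by (cases "s \<ge> 0") auto
    finally show "laplace_density s * ennreal (f \<bar>s\<bar>) \<le> ennreal (1/2) * ?e s + ennreal (1/2) * ?e (- s)" .
  qed
  also have "\<dots> = ennreal (1/2) * (\<integral>\<^sup>+s. ?e s \<partial>lborel) + ennreal (1/2) * (\<integral>\<^sup>+s. ?e (- s) \<partial>lborel)"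
    by (simp add: nn_integral_add nn_integral_cmult)
  also have "(\<integral>\<^sup>+s. ?e (- s) \<partial>lborel) = (\<integral>\<^sup>+s. ?e s \<partial>lborel)"
    using nn_integral_real_affine[of ?e "-1" 0] by simp
  also have "ennreal (1/2) * (\<integral>\<^sup>+s. ?e s \<partial>lborel) + ennreal (1/2) * (\<integral>\<^sup>+s. ?e s \<partial>lborel) = (\<integral>\<^sup>+s. ?e s \<partial>lborel)"
  proof -
    have "ennreal (1/2) + ennreal (1/2) = 1" by (subst ennreal_plus[symmetric]) simp_all
    then show ?thesis by (simp only: distrib_right[symmetric] mult_1_left)
  qed
  finally show ?thesis .
qed

lemma nn_integral_laplace_square: "(\<integral>\<^sup>+s. ennreal (s\<^sup>2) \<partial>laplace_measure) \<le> 2"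
  using nn_integral_laplace_abs_le[of "\<lambda>s. s\<^sup>2"] nn_integral_erlang_ith_moment[of 1 0 2] by simp

text \<open>The Laplace transform of the unit exponential at 1/2, read off from the density of rate
  3/2. It drives the Chernoff bound for the lower tail of the l1 norm.\<close>

lemma nn_integral_laplace_exp: "(\<integral>\<^sup>+s. ennreal (exp (- \<bar>s\<bar> / 2)) \<partial>laplace_measure) \<le> ennreal (2/3)"
proof -
  have "(\<integral>\<^sup>+s. ennreal (exp (- \<bar>s\<bar> / 2)) \<partial>laplace_measure)
      \<le> (\<integral>\<^sup>+x. ennreal (exponential_density 1 x * exp (- x / 2)) \<partial>lborel)"
    using nn_integral_laplace_abs_le[of "\<lambda>s. exp (- s / 2)"] by simp
  also have "\<dots> = (\<integral>\<^sup>+x. ennreal (2/3) * ennreal (exponential_density (3/2) x) \<partial>lborel)"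
    by (rule nn_integral_cong)
      (auto simp: exponential_density_def ennreal_mult'[symmetric] exp_add[symmetric] field_simps)
  also have "\<dots> = ennreal (2/3)"
    using nn_integral_erlang_ith_moment[of "3/2" 0 0] by (simp add: nn_integral_cmult)
  finally show ?thesis .
qed

text \<open>Continuous, because the transport inequality is only available for continuous functions.\<close>

definition cutoff :: "real ^ 'n \<Rightarrow> real" where
  "cutoff y = max 0 (min 1 (20 * (l1_norm y / CARD('n) - 7/10))) * max 0 (min 1 (5 - (norm y)\<^sup>2 / CARD('n)))"

lemma cutoff_range: "0 \<le> cutoff y" "cutoff y \<le> 1"
  by (auto simp: cutoff_def intro!: mult_nonneg_nonneg mult_le_one)

lemma cutoff_0: "cutoff 0 = 0"
  by (simp add: cutoff_def l1_norm_def)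

lemma continuous_on_l1_norm: "continuous_on UNIV l1_norm"
  unfolding l1_norm_def by (intro continuous_intros)

lemma continuous_on_cutoff: "continuous_on UNIV cutoff"
  unfolding cutoff_def
  by (intro continuous_intros continuous_on_l1_norm) auto

lemma cutoff_support:
  fixes y :: "real ^ 'n"
  assumes "cutoff y \<noteq> 0"
  shows "7/10 * CARD('n) \<le> l1_norm y" "(norm y)\<^sup>2 \<le> 5 * CARD('n)"
  using assms by (auto simp: cutoff_def max_def min_def field_simps split: if_splits)

text \<open>A union bound for the factors \<open>a\<close> and \<open>b\<close> of the cutoff. The
  loss in \<open>a\<close> occurs only below \<open>3/4 * d\<close> and is bounded by a Chernoff
  exponential; the loss in \<open>b\<close> occurs only where \<open>(norm y)\<^sup>2\<close>
  exceeds \<open>4 * d\<close> and is bounded as in Markov's inequality.\<close>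

lemma cutoff_lower:
  fixes y :: "real ^ 'n"
  shows "1 - exp ((3/4 * CARD('n) - l1_norm y) / 2) - (norm y)\<^sup>2 / (4 * CARD('n)) \<le> cutoff y"
proof -
  let ?d = "real CARD('n)"
  define a b where "a = max 0 (min 1 (20 * (l1_norm y / ?d - 7/10)))" and "b = max 0 (min 1 (5 - (norm y)\<^sup>2 / ?d))"
  have ab: "0 \<le> a" "a \<le> 1" "0 \<le> b" "b \<le> 1" by (auto simp: a_def b_def)
  have "1 - a \<le> exp ((3/4 * ?d - l1_norm y) / 2)"
  proof (cases "l1_norm y \<ge> 3/4 * ?d")
    case True
    then have "l1_norm y / ?d \<ge> 3/4" by (simp add: field_simps)
    then have "a = 1" by (simp add: a_def)
    then show ?thesis by simp
  next
    case False
    then have "1 \<le> exp ((3/4 * ?d - l1_norm y) / 2)" by simp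
    then show ?thesis using ab by linarith
  qed
  moreover have "1 - b \<le> (norm y)\<^sup>2 / (4 * ?d)"
  proof (cases "(norm y)\<^sup>2 / ?d \<le> 4")
    case True
    then have "b = 1" by (simp add: b_def)
    then show ?thesis by simp
  next
    case False
    then have "1 \<le> (norm y)\<^sup>2 / (4 * ?d)" by (simp add: field_simps)
    then show ?thesis using ab by linarith
  qed
  moreover have "0 \<le> (1 - a) * (1 - b)" using ab by simp
  then have "1 - (1 - a) - (1 - b) \<le> a * b" by (simp add: algebra_simps)
  ultimately show ?thesis unfolding cutoff_def a_def[symmetric] b_def[symmetric] by linarith
qed

text \<open>The Chernoff factor for the l1 norm: the base is at most 99/100, from
  \<open>exp (1/8) \<le> 73/64\<close>, and 300 dimensions bring the power down to
  \<open>exp (- 3)\<close> or less.\<close>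

lemma exp_three_eighths_power:
  assumes "300 \<le> n"
  shows "(exp (3/8) * (2/3)) ^ n \<le> (1/4 :: real)"
proof -
  have "exp (3/8) = exp (1/8 :: real) ^ 3" by (simp add: exp_of_nat_mult[symmetric])
  also have "\<dots> \<le> (73/64) ^ 3" using exp_bound[of "1/8"] by (intro power_mono) (auto simp: power2_eq_square)
  finally have "exp (3/8) * (2/3) \<le> (1 + (- 1/100) :: real)" by (simp add: power3_eq_cube)
  also have "\<dots> \<le> exp (- 1/100)" by (rule exp_ge_add_one_self)
  finally have "(exp (3/8) * (2/3)) ^ n \<le> exp (- 1/100 :: real) ^ n" by (intro power_mono) auto
  also have "\<dots> = exp (- real n / 100)" by (simp add: exp_of_nat_mult[symmetric])
  also have "\<dots> \<le> exp (- 3)" using assms by simp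
  also have "\<dots> \<le> 1/4" using exp_ge_add_one_self[of 3] by (simp add: exp_minus field_simps)
  finally show ?thesis .
qed

lemma distributed_laplace_bound:
  assumes D: "distributed M lborel Y laplace_density" and [measurable]: "f \<in> borel_measurable borel"
    and f: "\<And>x. 0 \<le> f x" and c: "0 \<le> c" "(\<integral>\<^sup>+s. ennreal (f s) \<partial>laplace_measure) \<le> ennreal c"
  shows "integrable M (\<lambda>\<omega>. f (Y \<omega>))" "(\<integral>\<omega>. f (Y \<omega>) \<partial>M) \<le> c"
proof -
  have [measurable]: "Y \<in> borel_measurable M" using distributed_measurable[OF D] by simp
  have "(\<integral>\<^sup>+\<omega>. ennreal (f (Y \<omega>)) \<partial>M) = (\<integral>\<^sup>+s. ennreal (f s) \<partial>laplace_measure)"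
    unfolding laplace_measure_def using distributed_nn_integral[OF D, of "\<lambda>s. ennreal (f s)"]
    by (simp add: nn_integral_density)
  then have le: "(\<integral>\<^sup>+\<omega>. ennreal (f (Y \<omega>)) \<partial>M) \<le> ennreal c" using c by simp
  then show "integrable M (\<lambda>\<omega>. f (Y \<omega>))"
    using f by (intro integrableI_nonneg) (auto intro: le_less_trans)
  show "(\<integral>\<omega>. f (Y \<omega>) \<partial>M) \<le> c" using c(1) le by (rule integral_real_bounded)
qed

text \<open>In the expectation of \<open>cutoff_lower\<close>, the Chernoff term factors by
  independence and costs at most 1/4; the norm term costs at most 1/2, as the second moments sum to
  at most \<open>2 * d\<close>.\<close>

lemma expectation_cutoff:
  fixes M :: "'a measure" and X :: "'a \<Rightarrow> real ^ 'n"
  assumes "prob_space M"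
    and indep: "prob_space.indep_vars M (\<lambda>_. borel) (\<lambda>i \<omega>. X \<omega> $ i) UNIV"
    and dist: "\<And>i. distributed M lborel (\<lambda>\<omega>. X \<omega> $ i) laplace_density"
    and d: "300 \<le> CARD('n)"
  shows "1/4 \<le> (\<integral>\<omega>. cutoff (X \<omega>) \<partial>M)"
proof -
  interpret prob_space M by fact
  let ?d = "real CARD('n)"
  have rv[measurable]: "(\<lambda>\<omega>. X \<omega> $ i) \<in> borel_measurable M" for i
    using distributed_measurable[OF dist[of i]] by simp
  then have X[measurable]: "X \<in> borel_measurable M" by (rule vec_borel_measurable)
  have E: "integrable M (\<lambda>\<omega>. exp (- \<bar>X \<omega> $ i\<bar> / 2))" "(\<integral>\<omega>. exp (- \<bar>X \<omega> $ i\<bar> / 2) \<partial>M) \<le> 2/3" for i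
    using distributed_laplace_bound[OF dist[of i], of "\<lambda>s. exp (- \<bar>s\<bar> / 2)" "2/3"] nn_integral_laplace_exp
    by simp_all
  have Sq: "integrable M (\<lambda>\<omega>. (X \<omega> $ i)\<^sup>2)" "(\<integral>\<omega>. (X \<omega> $ i)\<^sup>2 \<partial>M) \<le> 2" for i
    using distributed_laplace_bound[OF dist[of i], of "\<lambda>s. s\<^sup>2" 2] nn_integral_laplace_square
    by simp_all
  have indep': "indep_vars (\<lambda>_. borel) (\<lambda>i \<omega>. exp (- \<bar>X \<omega> $ i\<bar> / 2)) UNIV"
    by (rule indep_vars_compose2[OF indep]) measurable
  define Z where "Z \<omega> = (\<Prod>i\<in>UNIV. exp (- \<bar>X \<omega> $ i\<bar> / 2))" for \<omega>
  have Z: "integrable M Z" "(\<integral>\<omega>. Z \<omega> \<partial>M) \<le> (2/3) ^ CARD('n)"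
  proof -
    show "integrable M Z" unfolding Z_def by (rule indep_vars_integrable[OF _ indep' E(1)]) simp
    have "(\<integral>\<omega>. Z \<omega> \<partial>M) = (\<Prod>i\<in>UNIV. \<integral>\<omega>. exp (- \<bar>X \<omega> $ i\<bar> / 2) \<partial>M)"
      unfolding Z_def by (rule indep_vars_lebesgue_integral[OF _ indep' E(1)]) simp
    also have "\<dots> \<le> (\<Prod>i\<in>(UNIV :: 'n set). 2/3)" using E(2) by (intro prod_mono) auto
    finally show "(\<integral>\<omega>. Z \<omega> \<partial>M) \<le> (2/3) ^ CARD('n)" by simp
  qed
  have Zeq: "exp ((3/4 * ?d - l1_norm (X \<omega>)) / 2) = exp (3/8) ^ CARD('n) * Z \<omega>" for \<omega>
    unfolding Z_def l1_norm_def
    by (simp add: exp_sum[symmetric] exp_of_nat_mult[symmetric] exp_add[symmetric] sum_negf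
        sum_divide_distrib[symmetric] diff_divide_distrib)
  have N: "(norm (X \<omega>))\<^sup>2 = (\<Sum>i\<in>UNIV. (X \<omega> $ i)\<^sup>2)" for \<omega>
    by (simp add: norm_vec_def L2_set_def sum_nonneg)
  have Nint: "integrable M (\<lambda>\<omega>. (norm (X \<omega>))\<^sup>2)"
    unfolding N by (intro Bochner_Integration.integrable_sum Sq(1))
  have "(\<integral>\<omega>. (norm (X \<omega>))\<^sup>2 \<partial>M) = (\<Sum>i\<in>UNIV. \<integral>\<omega>. (X \<omega> $ i)\<^sup>2 \<partial>M)"
    unfolding N by (rule Bochner_Integration.integral_sum) (rule Sq(1))
  also have "\<dots> \<le> (\<Sum>i\<in>(UNIV :: 'n set). 2)" by (rule sum_mono) (rule Sq(2))
  finally have N2: "(\<integral>\<omega>. (norm (X \<omega>))\<^sup>2 \<partial>M) \<le> 2 * ?d" by simp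
  have "exp (3/8) ^ CARD('n) * (\<integral>\<omega>. Z \<omega> \<partial>M) \<le> exp (3/8) ^ CARD('n) * (2/3) ^ CARD('n)"
    using Z(2) by (intro mult_left_mono) auto
  also have "\<dots> \<le> 1/4" using exp_three_eighths_power[OF d] by (simp only: power_mult_distrib)
  finally have Z4: "exp (3/8) ^ CARD('n) * (\<integral>\<omega>. Z \<omega> \<partial>M) \<le> 1/4" .
  have "1/4 \<le> 1 - exp (3/8) ^ CARD('n) * (\<integral>\<omega>. Z \<omega> \<partial>M) - (\<integral>\<omega>. (norm (X \<omega>))\<^sup>2 \<partial>M) / (4 * ?d)"
  proof -
    have "(\<integral>\<omega>. (norm (X \<omega>))\<^sup>2 \<partial>M) / (4 * ?d) \<le> 1/2" using N2 by (simp add: field_simps)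
    then show ?thesis using Z4 by linarith
  qed
  also have "\<dots> = (\<integral>\<omega>. 1 - exp (3/8) ^ CARD('n) * Z \<omega> - (norm (X \<omega>))\<^sup>2 / (4 * ?d) \<partial>M)"
    using Z Nint prob_space by simp
  also have "\<dots> \<le> (\<integral>\<omega>. cutoff (X \<omega>) \<partial>M)"
  proof (rule integral_mono)
    show "integrable M (\<lambda>\<omega>. cutoff (X \<omega>))"
      using measurable_compose[OF X borel_measurable_continuous_onI[OF continuous_on_cutoff]]
      by (intro integrable_bounded[of _ _ 1] finite_measure_axioms) (simp_all add: cutoff_range)
    show "1 - exp (3/8) ^ CARD('n) * Z \<omega> - (norm (X \<omega>))\<^sup>2 / (4 * ?d) \<le> cutoff (X \<omega>)" for \<omega>
      using cutoff_lower[of "X \<omega>"] by (simp only: Zeq)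
  qed (use Z Nint in auto)
  finally show ?thesis .
qed

subsection \<open>Concentration\<close>

text \<open>At the origin \<open>1 / 0 = 0\<close> makes the value \<open>f 0\<close>, which the
  Lipschitz condition on the sphere does not control. Hence continuity is claimed off the origin,
  while measurability and boundedness survive a change at one point.\<close>

lemma normalize_measurable:
  fixes f :: "real ^ 'n \<Rightarrow> real"
  assumes lip: "1-lipschitz_on l1_sphere f"
  shows "continuous_on (- {0}) (\<lambda>x. f ((1 / l1_norm x) *\<^sub>R x))"
    "(\<lambda>x. f ((1 / l1_norm x) *\<^sub>R x)) \<in> borel_measurable borel"
    "\<exists>A. \<forall>x. \<bar>f ((1 / l1_norm x) *\<^sub>R x)\<bar> \<le> A"
proof -
  let ?h = "\<lambda>x. f ((1 / l1_norm x) *\<^sub>R x)"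
  show cont: "continuous_on (- {0}) ?h"
  proof (rule continuous_on_compose2[OF lipschitz_on_continuous_on[OF lip]])
    show "continuous_on (- {0}) (\<lambda>x :: real ^ 'n. (1 / l1_norm x) *\<^sub>R x)"
      by (intro continuous_intros continuous_on_subset[OF continuous_on_l1_norm]) (auto simp: l1_norm_eq_0_iff)
  qed (auto intro: normalize_in_l1_sphere simp del: scaleR_conv_of_real)
  have "(\<lambda>x. indicator (- {0}) x *\<^sub>R ?h x + indicator {0} x * f 0) \<in> borel_measurable borel"
    using cont by (intro borel_measurable_add borel_measurable_continuous_on_indicator) auto
  also have "(\<lambda>x. indicator (- {0}) x *\<^sub>R ?h x + indicator {0} x * f 0) = ?h"
    by (auto simp: indicator_def fun_eq_iff)
  finally show "?h \<in> borel_measurable borel" .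
  \<comment> \<open>A reference point: all of the sphere lies within distance 2 of it, and
    \<open>\<bar>f 0\<bar>\<close> in the bound covers the origin.\<close>
  define u where "u = (1 / l1_norm (1 :: real ^ 'n)) *\<^sub>R (1 :: real ^ 'n)"
  have u: "u \<in> l1_sphere" unfolding u_def by (rule normalize_in_l1_sphere) simp
  have "\<bar>?h x\<bar> \<le> \<bar>f u\<bar> + 2 + \<bar>f 0\<bar>" for x
  proof (cases "x = 0")
    case False
    then have v: "(1 / l1_norm x) *\<^sub>R x \<in> l1_sphere" (is "?v \<in> _") by (rule normalize_in_l1_sphere)
    have "\<bar>f ?v - f u\<bar> \<le> norm (?v - u)" using lipschitz_onD[OF lip v u] by (simp add: dist_norm)
    also have "\<dots> \<le> 2"
      using norm_triangle_ineq4[of ?v u] norm_le_1_l1_sphere[OF u] norm_le_1_l1_sphere[OF v] by linarith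
    finally show ?thesis by linarith
  qed simp
  then show "\<exists>A. \<forall>x. \<bar>?h x\<bar> \<le> A" by blast
qed

text \<open>Repairs the possible jump at the origin: a bounded factor is damped by one that vanishes
  there.\<close>

lemma continuous_on_mult_vanishing:
  fixes a e :: "real ^ 'n \<Rightarrow> real"
  assumes a: "continuous_on UNIV a" "a 0 = 0" and e: "continuous_on (- {0}) e" "\<And>x. \<bar>e x\<bar> \<le> K"
  shows "continuous_on UNIV (\<lambda>x. a x * e x)"
proof (rule continuous_at_imp_continuous_on, rule ballI)
  fix x :: "real ^ 'n"
  have ax: "isCont a y" for y using a by (simp add: continuous_on_eq_continuous_at)
  show "isCont (\<lambda>x. a x * e x) x"
  proof (cases "x = 0")
    case False
    then have "isCont e x" using e(1) by (simp add: continuous_on_eq_continuous_at open_Compl)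
    with ax show ?thesis by (intro continuous_intros)
  next
    case True
    have "((\<lambda>x. a x * e x) \<longlongrightarrow> 0) (at 0)"
    proof (rule Lim_null_comparison)
      have "norm (a y * e y) \<le> \<bar>a y\<bar> * K" for y
        using e(2)[of y] by (simp add: abs_mult mult_left_mono)
      then show "\<forall>\<^sub>F y in at 0. norm (a y * e y) \<le> \<bar>a y\<bar> * K" by simp
      have "((\<lambda>y. \<bar>a y\<bar> * K) \<longlongrightarrow> \<bar>a 0\<bar> * K) (at 0)"
        using ax[of 0] by (intro tendsto_intros) (simp add: isCont_def)
      then show "((\<lambda>y. \<bar>a y\<bar> * K) \<longlongrightarrow> 0) (at 0)" using a(2) by simp
    qed
    then show ?thesis using True a(2) by (simp add: isCont_def)
  qed
qed

lemma laplace_AE_nonzero: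
  fixes X :: "'a \<Rightarrow> real ^ 'n"
  assumes "prob_space M"
    and dist: "\<And>i. distributed M lborel (\<lambda>\<omega>. X \<omega> $ i) laplace_density"
  shows "AE \<omega> in M. X \<omega> \<noteq> 0"
proof -
  fix i :: 'n
  have "AE s in lborel. 0 < laplace_density s \<longrightarrow> s \<noteq> 0"
    using AE_lborel_singleton[of 0] by eventually_elim simp
  then have "AE \<omega> in M. X \<omega> $ i \<noteq> 0"
    by (subst prob_space.distributed_AE2[OF assms(1) dist[of i]]) auto
  then show ?thesis by eventually_elim auto
qed

text \<open>The transport inequality for a damped \<open>exp (\<theta> * h)\<close>, divided by
  \<open>exp (13/100)\<close>, against the cutoff version of \<open>exp (- \<theta> * h)\<close>.
  The comparison of \<open>lipschitz_normalize_cost\<close> is its hypothesis, and the damping is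
  removed in the limit.\<close>

lemma exp_moment_product:
  fixes M :: "'a measure" and X :: "'a \<Rightarrow> real ^ 'n" and f :: "real ^ 'n \<Rightarrow> real"
  defines "h \<equiv> \<lambda>\<omega>. f ((1 / l1_norm (X \<omega>)) *\<^sub>R X \<omega>)" and "\<theta> \<equiv> 3/1000 * real CARD('n)"
  assumes "prob_space M"
    and indep: "prob_space.indep_vars M (\<lambda>_. borel) (\<lambda>i \<omega>. X \<omega> $ i) UNIV"
    and dist: "\<And>i. distributed M lborel (\<lambda>\<omega>. X \<omega> $ i) laplace_density"
    and lip: "1-lipschitz_on l1_sphere f"
  shows "(\<integral>\<omega>. exp (\<theta> * h \<omega>) \<partial>M) * (\<integral>\<omega>. cutoff (X \<omega>) * exp (- \<theta> * h \<omega>) \<partial>M) \<le> exp (13/100)"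
proof -
  interpret prob_space M by fact
  define g where "g x = f ((1 / l1_norm x) *\<^sub>R x)" for x
  have hg: "h \<omega> = g (X \<omega>)" for \<omega> by (simp add: h_def g_def)
  have cont: "continuous_on (- {0}) g" and [measurable]: "g \<in> borel_measurable borel"
    using normalize_measurable[OF lip] by (simp_all add: g_def[abs_def])
  obtain A where A: "\<And>x. \<bar>g x\<bar> \<le> A" using normalize_measurable(3)[OF lip] by (auto simp: g_def)
  have \<theta>: "\<theta> > 0" by (simp add: \<theta>_def)
  have [measurable]: "(\<lambda>\<omega>. X \<omega> $ i) \<in> borel_measurable M" for i
    using distributed_measurable[OF dist[of i]] by simp
  then have X[measurable]: "X \<in> borel_measurable M" by (rule vec_borel_measurable)
  have [measurable]: "l1_norm \<in> borel_measurable borel"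
    by (rule borel_measurable_continuous_onI[OF continuous_on_l1_norm])
  define K where "K = exp (\<theta> * A)"
  have K: "exp (\<theta> * g x) \<le> K" "exp (- \<theta> * g x) \<le> K" for x
  proof -
    have "\<theta> * \<bar>g x\<bar> \<le> \<theta> * A" using A[of x] \<theta> by (intro mult_left_mono) auto
    then have "\<bar>\<theta> * g x\<bar> \<le> \<theta> * A" using \<theta> by (simp add: abs_mult)
    then show "exp (\<theta> * g x) \<le> K" "exp (- \<theta> * g x) \<le> K" by (auto simp: K_def abs_le_iff)
  qed
  have K0: "0 \<le> K" by (simp add: K_def)
  define J where "J = (\<integral>\<omega>. cutoff (X \<omega>) * exp (- \<theta> * h \<omega>) \<partial>M)"
  \<comment> \<open>The factor \<open>min 1 (k * l1_norm x)\<close> removes the discontinuity of \<open>g\<close> at the origin.\<close>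
  define F where "F k x = min 1 (real k * l1_norm x) * exp (\<theta> * g x)" for k x
  have F: "0 \<le> F k x" "F k x \<le> exp (\<theta> * g x)" "F k x \<le> K" for k x
  proof -
    show F: "0 \<le> F k x" by (simp add: F_def l1_norm_nonneg)
    show "F k x \<le> exp (\<theta> * g x)" unfolding F_def by (simp add: mult_le_cancel_right1)
    then show "F k x \<le> K" using K order_trans by blast
  qed
  have [measurable]: "F k \<in> borel_measurable borel" for k
    unfolding F_def[abs_def] by measurable
  have Fk: "(\<integral>\<omega>. F k (X \<omega>) \<partial>M) * J \<le> exp (13/100)" for k
  proof -
    have "(\<integral>\<omega>. F k (X \<omega>) / exp (13/100) \<partial>M) * (\<integral>\<omega>. cutoff (X \<omega>) * exp (- \<theta> * g (X \<omega>)) \<partial>M) \<le> 1"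
    proof (rule laplace_transport_vec[OF \<open>prob_space M\<close> indep dist, where B = K])
      have "continuous_on UNIV (F k)" unfolding F_def[abs_def]
        by (rule continuous_on_mult_vanishing[where K = K])
          (use K in \<open>auto simp: l1_norm_eq_0_iff intro!: continuous_intros cont continuous_on_l1_norm\<close>)
      then show "continuous_on UNIV (\<lambda>x. F k x / exp (13/100))" by (intro continuous_intros) auto
      show "continuous_on UNIV (\<lambda>x. cutoff x * exp (- \<theta> * g x))"
        by (rule continuous_on_mult_vanishing[where K = K])
          (use K in \<open>auto simp: cutoff_0 intro!: continuous_intros cont continuous_on_cutoff\<close>)
    next
      fix x y :: "real ^ 'n"
      show "F k x / exp (13/100) \<le> K"
      proof -
        have "F k x / exp (13/100) \<le> F k x / 1" using F(1) by (intro divide_left_mono) auto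
        then show ?thesis using F(3)[of k x] by linarith
      qed
      show "0 \<le> F k x / exp (13/100)" using F by simp
      show "0 \<le> cutoff x * exp (- \<theta> * g x)" by (simp add: cutoff_range)
      show "cutoff x * exp (- \<theta> * g x) \<le> K"
        using mult_mono[OF cutoff_range(2) K(2) _ _, of x x] by simp
      show "F k x / exp (13/100) * (cutoff y * exp (- \<theta> * g y)) \<le> exp (\<Sum>i\<in>UNIV. laplace_cost (x $ i - y $ i))"
      \<comment> \<open>For \<open>x = 0\<close> the first factor vanishes, for
        \<open>cutoff y = 0\<close> the second; otherwise \<open>y\<close> is typical.\<close>
      proof (cases "x = 0 \<or> cutoff y = 0")
        case True
        then show ?thesis by (auto simp: F_def l1_norm_def)
      next
        case False
        then have "3/1000 * real CARD('n) * \<bar>g x - g y\<bar> \<le> 13/100 + (\<Sum>i\<in>UNIV. laplace_cost (x $ i - y $ i))"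
          unfolding g_def using cutoff_support[of y] lip by (intro lipschitz_normalize_cost) auto
        moreover have "\<theta> * (g x - g y) \<le> \<theta> * \<bar>g x - g y\<bar>" using \<theta> by (intro mult_left_mono) auto
        ultimately have le: "\<theta> * g x - \<theta> * g y - 13/100 \<le> (\<Sum>i\<in>UNIV. laplace_cost (x $ i - y $ i))"
          by (simp add: \<theta>_def algebra_simps)
        have "F k x / exp (13/100) * (cutoff y * exp (- \<theta> * g y)) \<le> exp (\<theta> * g x) / exp (13/100) * (1 * exp (- \<theta> * g y))"
          by (intro mult_mono divide_right_mono) (auto simp: F cutoff_range)
        also have "\<dots> = exp (\<theta> * g x - \<theta> * g y - 13/100)"
        proof -
          have "exp a / exp c * (1 * exp (- b)) = exp (a - b - c)" for a b c :: real
            by (simp add: exp_diff exp_minus exp_add field_simps)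
          from this[of "\<theta> * g x" "13/100" "\<theta> * g y"] show ?thesis
            by (simp only: mult_minus_left)
        qed
        also have "\<dots> \<le> exp (\<Sum>i\<in>UNIV. laplace_cost (x $ i - y $ i))" using le by simp
        finally show ?thesis .
      qed
    qed
    then show ?thesis by (simp add: J_def hg divide_le_eq)
  qed
  \<comment> \<open>Off the null event \<open>X \<omega> = 0\<close> the damping factor equals 1 for
    all large \<open>k\<close>.\<close>
  have "(\<lambda>k. \<integral>\<omega>. F k (X \<omega>) \<partial>M) \<longlonglongrightarrow> (\<integral>\<omega>. exp (\<theta> * h \<omega>) \<partial>M)"
  proof (rule integral_dominated_convergence[where w = "\<lambda>_. K"])
    show "(\<lambda>\<omega>. exp (\<theta> * h \<omega>)) \<in> borel_measurable M" unfolding hg by measurable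
    show "AE \<omega> in M. (\<lambda>k. F k (X \<omega>)) \<longlonglongrightarrow> exp (\<theta> * h \<omega>)"
      using laplace_AE_nonzero[OF \<open>prob_space M\<close> dist]
    proof eventually_elim
      case (elim \<omega>)
      then have pos: "0 < l1_norm (X \<omega>)"
        using l1_norm_eq_0_iff[of "X \<omega>"] l1_norm_nonneg[of "X \<omega>"] by linarith
      obtain k0 :: nat where k0: "1 < real k0 * l1_norm (X \<omega>)" using ex_less_of_nat_mult[OF pos] by blast
      have "F k (X \<omega>) = exp (\<theta> * h \<omega>)" if "k \<ge> k0" for k
      proof -
        have "real k0 * l1_norm (X \<omega>) \<le> real k * l1_norm (X \<omega>)" using that pos by (intro mult_right_mono) auto
        then show ?thesis using k0 by (simp add: F_def hg)
      qed
      then show ?case by (intro tendsto_eventually) (auto simp: eventually_sequentially)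
    qed
    show "AE \<omega> in M. norm (F k (X \<omega>)) \<le> K" for k using F by simp
  qed simp_all
  then have "(\<lambda>k. (\<integral>\<omega>. F k (X \<omega>) \<partial>M) * J) \<longlonglongrightarrow> (\<integral>\<omega>. exp (\<theta> * h \<omega>) \<partial>M) * J"
    by (intro tendsto_intros)
  then show ?thesis using Fk unfolding J_def by (intro LIMSEQ_le_const2) auto
qed

text \<open>Multiplying the two product bounds and using Cauchy-Schwarz for the weighted moments
  bounds the product of the plain moments by \<open>(c / e)\<^sup>2\<close>. Centring keeps this
  product and makes both factors at least 1, which bounds their sum; Markov's inequality
  finishes.\<close>

lemma exp_moment_pair_bound:
  fixes h w :: "'a \<Rightarrow> real" and \<theta> c e :: real
  assumes "prob_space M" and [measurable]: "h \<in> borel_measurable M" "w \<in> borel_measurable M"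
    and hA: "\<And>\<omega>. \<bar>h \<omega>\<bar> \<le> A" and w: "\<And>\<omega>. 0 \<le> w \<omega>" "\<And>\<omega>. w \<omega> \<le> 1"
    and e: "0 < e" "e \<le> (\<integral>\<omega>. w \<omega> \<partial>M)"
    and pq: "(\<integral>\<omega>. exp (\<theta> * h \<omega>) \<partial>M) * (\<integral>\<omega>. w \<omega> * exp (- \<theta> * h \<omega>) \<partial>M) \<le> c"
      "(\<integral>\<omega>. exp (- \<theta> * h \<omega>) \<partial>M) * (\<integral>\<omega>. w \<omega> * exp (\<theta> * h \<omega>) \<partial>M) \<le> c"
    and \<theta>: "0 \<le> \<theta>"
  shows "measure M {\<omega> \<in> space M. \<bar>h \<omega> - (\<integral>\<omega>. h \<omega> \<partial>M)\<bar> > r} \<le> (1 + (c / e)\<^sup>2) * exp (- \<theta> * r)"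
proof -
  interpret prob_space M by fact
  define m where "m = expectation h"
  define K where "K = exp (\<theta> * A)"
  have K: "exp (\<theta> * h \<omega>) \<le> K" "exp (- \<theta> * h \<omega>) \<le> K" for \<omega>
  proof -
    have "\<theta> * \<bar>h \<omega>\<bar> \<le> \<theta> * A" using hA \<theta> by (intro mult_left_mono) auto
    then have "\<bar>\<theta> * h \<omega>\<bar> \<le> \<theta> * A" using \<theta> by (simp add: abs_mult)
    then show "exp (\<theta> * h \<omega>) \<le> K" "exp (- \<theta> * h \<omega>) \<le> K" by (auto simp: K_def abs_le_iff)
  qed
  have wK: "w \<omega> * exp (\<theta> * h \<omega>) \<le> K" "w \<omega> * exp (- \<theta> * h \<omega>) \<le> K" for \<omega>
    using mult_mono[OF w(2) K(1), of \<omega> \<omega>] mult_mono[OF w(2) K(2), of \<omega> \<omega>] by auto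
  have int: "integrable M h" "integrable M w"
    using hA w by (auto intro: integrable_bounded[of M _ A] integrable_bounded[of M _ 1] finite_measure_axioms)
  have intK: "integrable M g" if "g \<in> borel_measurable M" "\<And>\<omega>. 0 \<le> g \<omega>" "\<And>\<omega>. g \<omega> \<le> K" for g
    using that by (intro integrable_bounded[of M _ K] finite_measure_axioms) auto
  have int_exp: "integrable M (\<lambda>\<omega>. exp (\<theta> * h \<omega>))" "integrable M (\<lambda>\<omega>. exp (- \<theta> * h \<omega>))"
      "integrable M (\<lambda>\<omega>. w \<omega> * exp (\<theta> * h \<omega>))" "integrable M (\<lambda>\<omega>. w \<omega> * exp (- \<theta> * h \<omega>))"
    by (rule intK; use w K wK in simp)+
  note int = int int_exp
  define p q where "p = (\<integral>\<omega>. exp (\<theta> * h \<omega>) \<partial>M)" and "q = (\<integral>\<omega>. exp (- \<theta> * h \<omega>) \<partial>M)"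
  define p' q' where "p' = (\<integral>\<omega>. w \<omega> * exp (\<theta> * h \<omega>) \<partial>M)" and "q' = (\<integral>\<omega>. w \<omega> * exp (- \<theta> * h \<omega>) \<partial>M)"
  have nonneg: "0 \<le> p" "0 \<le> q" "0 \<le> p'" "0 \<le> q'"
    unfolding p_def q_def p'_def q'_def using w by (auto intro!: integral_nonneg)
  \<comment> \<open>Cauchy-Schwarz as a quadratic inequality in \<open>t\<close>, obtained by
    integrating \<open>w \<omega> * (t * s - inverse s)\<^sup>2 \<ge> 0\<close>.\<close>
  have quad: "2 * t * e \<le> t\<^sup>2 * p' + q'" if t: "t \<ge> 0" for t
  proof -
    have "2 * t * e \<le> 2 * t * (\<integral>\<omega>. w \<omega> \<partial>M)" using e t by (intro mult_left_mono) auto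
    also have "\<dots> = (\<integral>\<omega>. 2 * t * w \<omega> \<partial>M)" by simp
    also have "\<dots> \<le> (\<integral>\<omega>. t\<^sup>2 * (w \<omega> * exp (\<theta> * h \<omega>)) + w \<omega> * exp (- \<theta> * h \<omega>) \<partial>M)"
    proof (rule integral_mono)
      fix \<omega>
      define s where "s = exp (\<theta> * h \<omega> / 2)"
      have s: "exp (\<theta> * h \<omega>) = s\<^sup>2" "exp (- \<theta> * h \<omega>) = (inverse s)\<^sup>2"
        by (simp_all add: s_def exp_double[symmetric] exp_minus[symmetric])
      have inv: "s * inverse s = 1" by (simp add: s_def)
      have "0 \<le> w \<omega> * (t * s - inverse s)\<^sup>2" using w by simp
      also have "\<dots> = t\<^sup>2 * (w \<omega> * s\<^sup>2) + w \<omega> * (inverse s)\<^sup>2 - 2 * t * w \<omega> * (s * inverse s)"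
        by (simp only: power2_diff power2_eq_square) algebra
      finally show "2 * t * w \<omega> \<le> t\<^sup>2 * (w \<omega> * exp (\<theta> * h \<omega>)) + w \<omega> * exp (- \<theta> * h \<omega>)"
        unfolding s inv by simp
    qed (use int in auto)
    also have "\<dots> = t\<^sup>2 * p' + q'" unfolding p'_def q'_def using int by simp
    finally show ?thesis .
  qed
  \<comment> \<open>Optimise over \<open>t\<close>: for \<open>p' > 0\<close> the best choice is
    \<open>e / p'\<close>; for \<open>p' = 0\<close> the chosen \<open>t\<close> yields the
    contradiction \<open>2 * (q' + 1) \<le> q'\<close>.\<close>
  have e2: "e\<^sup>2 \<le> p' * q'"
  proof (cases "p' = 0")
    case True
    have "2 * ((q' + 1) / e) * e \<le> ((q' + 1) / e)\<^sup>2 * p' + q'" using e nonneg by (intro quad) auto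
    then show ?thesis using True e nonneg by simp
  next
    case False
    then have "p' > 0" using nonneg by simp
    then show ?thesis using quad[of "e / p'"] e by (simp add: power2_eq_square field_simps)
  qed
  have "(p * q) * e\<^sup>2 \<le> (p * q) * (p' * q')" using e2 nonneg by (intro mult_left_mono) auto
  also have "\<dots> = (p * q') * (q * p')" by (simp only: mult_ac)
  also have "\<dots> \<le> c * c" using pq nonneg unfolding p_def[symmetric] q_def[symmetric] p'_def[symmetric] q'_def[symmetric]
    by (intro mult_mono) (auto intro: order_trans[of _ "p * q'"])
  finally have pq2: "p * q \<le> (c / e)\<^sup>2" using e by (simp add: power2_eq_square field_simps)
  define a b where "a = exp (- \<theta> * m) * p" and "b = exp (\<theta> * m) * q"
  have a: "a = (\<integral>\<omega>. exp (\<theta> * (h \<omega> - m)) \<partial>M)"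
    unfolding a_def p_def by (simp add: exp_diff exp_minus right_diff_distrib field_simps)
  have b: "b = (\<integral>\<omega>. exp (- \<theta> * (h \<omega> - m)) \<partial>M)"
    unfolding b_def q_def integral_mult_right_zero[symmetric] by (simp add: exp_add[symmetric] algebra_simps)
  have int': "integrable M (\<lambda>\<omega>. exp (\<theta> * (h \<omega> - m)))" "integrable M (\<lambda>\<omega>. exp (- \<theta> * (h \<omega> - m)))"
    using integrable_mult_right[OF int(3), of "exp (- \<theta> * m)"] integrable_mult_right[OF int(4), of "exp (\<theta> * m)"]
    by (simp_all add: exp_add[symmetric] algebra_simps)
  \<comment> \<open>Jensen's inequality by way of \<open>1 + u \<le> exp u\<close>, as
    \<open>h - m\<close> has mean 0.\<close>
  have "(\<integral>\<omega>. 1 + \<theta> * (h \<omega> - m) \<partial>M) \<le> a"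
    unfolding a using int int' by (intro integral_mono) auto
  moreover have "(\<integral>\<omega>. 1 + - \<theta> * (h \<omega> - m) \<partial>M) \<le> b"
    unfolding b
  proof (rule integral_mono)
    show "1 + - \<theta> * (h \<omega> - m) \<le> exp (- \<theta> * (h \<omega> - m))" for \<omega>
      by (rule exp_ge_add_one_self)
  qed (use int int' in auto)
  ultimately have ab1: "1 \<le> a" "1 \<le> b"
    using int by (simp_all add: m_def prob_space)
  have "a * b = p * q" by (simp add: a_def b_def exp_minus field_simps)
  \<comment> \<open>Turns the bound on the product into one on the sum:
    \<open>a + b \<le> 1 + a * b\<close>.\<close>
  moreover have "0 \<le> (a - 1) * (b - 1)" using ab1 by simp
  ultimately have ab: "a + b \<le> 1 + (c / e)\<^sup>2" using pq2 by (simp add: algebra_simps)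
  let ?S = "{\<omega> \<in> space M. \<bar>h \<omega> - m\<bar> > r}"
  have "measure M ?S = (\<integral>\<omega>. indicator ?S \<omega> \<partial>M)" by simp
  also have "\<dots> \<le> (\<integral>\<omega>. exp (- \<theta> * r) * (exp (\<theta> * (h \<omega> - m)) + exp (- \<theta> * (h \<omega> - m))) \<partial>M)"
  proof (rule integral_mono)
    show "integrable M (indicator ?S :: 'a \<Rightarrow> real)"
      by (intro integrable_bounded[of M _ 1] finite_measure_axioms) (auto simp: indicator_def)
  next
    fix \<omega>
    show "indicator ?S \<omega> \<le> exp (- \<theta> * r) * (exp (\<theta> * (h \<omega> - m)) + exp (- \<theta> * (h \<omega> - m)))"
    proof (cases "\<omega> \<in> ?S")
      case True
      then have "\<theta> * r \<le> \<theta> * \<bar>h \<omega> - m\<bar>" using \<theta> by (intro mult_left_mono) auto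
      then have "exp (\<theta> * r) \<le> exp (\<theta> * \<bar>h \<omega> - m\<bar>)" by simp
      also have "\<dots> \<le> exp (\<theta> * (h \<omega> - m)) + exp (- \<theta> * (h \<omega> - m))"
      proof -
        have "exp (\<theta> * \<bar>u\<bar>) \<le> exp (\<theta> * u) + exp (- \<theta> * u)" for u :: real
          by (cases "u \<ge> 0") simp_all
        then show ?thesis .
      qed
      finally have "exp (- \<theta> * r) * exp (\<theta> * r) \<le> exp (- \<theta> * r) * (exp (\<theta> * (h \<omega> - m)) + exp (- \<theta> * (h \<omega> - m)))"
        by (intro mult_left_mono) auto
      then show ?thesis using True by (simp add: exp_add[symmetric])
    qed simp
  qed (use int' in auto)
  also have "\<dots> = exp (- \<theta> * r) * (a + b)" unfolding a b using int' by simp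
  also have "\<dots> \<le> exp (- \<theta> * r) * (1 + (c / e)\<^sup>2)" using ab by (intro mult_left_mono) auto
  finally show ?thesis by (simp add: m_def mult.commute)
qed

theorem theorem2:
  fixes M :: "'a measure" and X :: "'a \<Rightarrow> real ^ 'n"
    and f :: "real ^ 'n \<Rightarrow> real" and r :: real
  assumes "prob_space M"
    and "prob_space.indep_vars M (\<lambda>_. borel) (\<lambda>i \<omega>. X \<omega> $ i) UNIV"
    and "\<And>i. distributed M lborel (\<lambda>\<omega>. X \<omega> $ i) laplace_density"
    and "1-lipschitz_on l1_sphere f"
    and "r > 0"
  shows "prob_space.prob M
           {\<omega> \<in> space M.
              \<bar>f ((1 / (\<Sum>j\<in>UNIV. \<bar>X \<omega> $ j\<bar>)) *\<^sub>R X \<omega>)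
               - prob_space.expectation M (\<lambda>\<omega>'. f ((1 / (\<Sum>j\<in>UNIV. \<bar>X \<omega>' $ j\<bar>)) *\<^sub>R X \<omega>'))\<bar> > r}
         \<le> 361 * exp (- 0.003 * r * real CARD('n))"
proof -
  interpret prob_space M by fact
  note indep = assms(2) and dist = assms(3) and lip = assms(4) and r = assms(5)
  define h where "h \<omega> = f ((1 / l1_norm (X \<omega>)) *\<^sub>R X \<omega>)" for \<omega>
  define \<theta> where "\<theta> = 3/1000 * real CARD('n)"
  define m where "m = expectation h"
  have \<theta>: "\<theta> > 0" by (simp add: \<theta>_def)
  have [measurable]: "(\<lambda>\<omega>. X \<omega> $ i) \<in> borel_measurable M" for i
    using distributed_measurable[OF dist[of i]] by simp
  then have X[measurable]: "X \<in> borel_measurable M" by (rule vec_borel_measurable)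
  have h[measurable]: "h \<in> borel_measurable M"
    unfolding h_def[abs_def] by (rule measurable_compose[OF X normalize_measurable(2)[OF lip]])
  obtain A where A: "\<And>\<omega>. \<bar>h \<omega>\<bar> \<le> A" using normalize_measurable(3)[OF lip] by (auto simp: h_def)
  have inth: "integrable M h" by (rule integrable_bounded[OF finite_measure_axioms h A])
  have "prob {\<omega> \<in> space M. \<bar>h \<omega> - m\<bar> > r} \<le> 361 * exp (- \<theta> * r)"
  \<comment> \<open>The bound 1/4 on the mean of the cutoff is available from dimension 300 on;
    below that the claim is elementary.\<close>
  proof (cases "300 \<le> CARD('n)")
    case True
    \<comment> \<open>The second product is the first one for \<open>- f\<close>.\<close>
    have moment: "(\<integral>\<omega>. exp (\<theta> * h \<omega>) \<partial>M) * (\<integral>\<omega>. cutoff (X \<omega>) * exp (- \<theta> * h \<omega>) \<partial>M) \<le> exp (13/100)"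
      "(\<integral>\<omega>. exp (- \<theta> * h \<omega>) \<partial>M) * (\<integral>\<omega>. cutoff (X \<omega>) * exp (\<theta> * h \<omega>) \<partial>M) \<le> exp (13/100)"
      using exp_moment_product[OF assms(1-4)]
        exp_moment_product[OF assms(1-3), of "\<lambda>x. - f x"] lip
      by (simp_all add: h_def \<theta>_def lipschitz_on_def)
    have "prob {\<omega> \<in> space M. \<bar>h \<omega> - m\<bar> > r} \<le> (1 + (exp (13/100) / (1/4))\<^sup>2) * exp (- \<theta> * r)"
      unfolding m_def
    proof (rule exp_moment_pair_bound[OF assms(1) h _ A cutoff_range _ _ moment])
      show "(\<lambda>\<omega>. cutoff (X \<omega>)) \<in> borel_measurable M"
        by (rule measurable_compose[OF X borel_measurable_continuous_onI[OF continuous_on_cutoff]])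
    qed (use expectation_cutoff[OF assms(1-3) True] \<theta> in auto)
    also have "\<dots> \<le> 361 * exp (- \<theta> * r)"
    proof (rule mult_right_mono)
      have "exp (13/100 :: real) \<le> 2" using exp_bound[of "13/100"] by (simp add: power2_eq_square)
      then have "exp (13/100 :: real) / (1/4) \<le> 8" by simp
      then have "(exp (13/100 :: real) / (1/4))\<^sup>2 \<le> 8\<^sup>2" by (intro power_mono) auto
      then show "1 + (exp (13/100) / (1/4))\<^sup>2 \<le> (361 :: real)" by simp
    qed simp
    finally show ?thesis .
  next
    case False
    show ?thesis
    proof (cases "r < 2")
      case True
      \<comment> \<open>In this range the claimed bound exceeds 1: it is at least
        \<open>361 * exp (- 2)\<close>.\<close>
      have "\<theta> * r \<le> 9/10 * 2" using False True r by (intro mult_mono) (auto simp: \<theta>_def)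
      then have "exp (- 2) \<le> exp (- \<theta> * r)" by simp
      moreover have "1 \<le> 361 * exp (- 2 :: real)"
      proof -
        have "exp (2 :: real) = exp 1 * exp 1" by (simp add: exp_add[symmetric])
        also have "\<dots> \<le> 3 * 3" using exp_le by (intro mult_mono) auto
        finally show ?thesis by (simp add: exp_minus field_simps)
      qed
      ultimately show ?thesis using prob_le_1[of "{\<omega> \<in> space M. \<bar>h \<omega> - m\<bar> > r}"] by linarith
    next
      case r2: False
      have ae: "AE \<omega> in M. X \<omega> \<noteq> 0" by (rule laplace_AE_nonzero[OF assms(1) dist])
      \<comment> \<open>The sphere has Euclidean diameter at most 2, so \<open>h\<close> almost
        surely differs from its mean by at most 2, and the event is null.\<close>
      have osc: "\<bar>h \<omega> - h \<omega>'\<bar> \<le> 2" if "X \<omega> \<noteq> 0" "X \<omega>' \<noteq> 0" for \<omega> \<omega>'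
      proof -
        note S = normalize_in_l1_sphere[OF that(1)] normalize_in_l1_sphere[OF that(2)]
        have "\<bar>h \<omega> - h \<omega>'\<bar> \<le> norm ((1 / l1_norm (X \<omega>)) *\<^sub>R X \<omega> - (1 / l1_norm (X \<omega>')) *\<^sub>R X \<omega>')"
          using lipschitz_onD[OF lip S] by (simp add: h_def dist_norm)
        also have "\<dots> \<le> 2"
          using norm_triangle_ineq4 norm_le_1_l1_sphere[OF S(1)] norm_le_1_l1_sphere[OF S(2)]
          by (smt (verit))
        finally show ?thesis .
      qed
      have "AE \<omega> in M. \<not> \<bar>h \<omega> - m\<bar> > r"
        using ae
      proof eventually_elim
        case (elim \<omega>)
        have "AE \<omega>' in M. h \<omega>' \<le> h \<omega> + 2" "AE \<omega>' in M. h \<omega> - 2 \<le> h \<omega>'"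
          using ae by (eventually_elim, use osc[OF elim] in \<open>fastforce simp: abs_le_iff\<close>)+
        then have "m \<le> h \<omega> + 2" "h \<omega> - 2 \<le> m"
          using integral_mono_AE[OF inth integrable_const[of "h \<omega> + 2"]]
            integral_mono_AE[OF integrable_const[of "h \<omega> - 2"] inth]
          by (auto simp: m_def prob_space)
        then show ?case using r2 by linarith
      qed
      then have "prob {\<omega> \<in> space M. \<bar>h \<omega> - m\<bar> > r} = 0"
        by (subst prob_eq_0) auto
      then show ?thesis by simp
    qed
  qed
  also have "- \<theta> * r = - 0.003 * r * real CARD('n)" by (simp add: \<theta>_def)
  finally show ?thesis by (simp add: h_def[abs_def] m_def l1_norm_def)
qed

end
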